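(* Let $G$ be a countably infinite group and let $G\curvearrowright (X,\mu )$ be a free probability measure preserving action of $G$ (a Borel action on a standard Borel space $X$ with $G$-invariant Borel probability measure $\mu$). Then for any $\epsilon >0$ there exists a factor map $f:(X,\mu ) \to (Z,\eta )$ onto a free action $G\curvearrowright (Z,\eta )$ which admits a $2$-piece generating partition $\{ C_0, C_1 \}$ with $H_\eta (\{ C_0, C_1 \} ) < \epsilon$.
   Context: A factor map $f:(X,\mu)\to(Z,\eta)$ between probability measure preserving actions of $G$ on standard probability spaces is a $G$-equivariant Borel map with $f_*\mu=\eta$. A generating partition for a Borel action $G\curvearrowright Z$ is a countable Borel partition $\mathcal{P}$ of $Z$ such that the smallest $G$-invariant $\sigma$-algebra containing $\mathcal{P}$ is the entire Borel $\sigma$-algebra; equivalently, for all $x\neq y$ in $Z$ there is $g\in G$ such that $\mathcal{P}$ separates $g\cdot x$ and $g\cdot y$. For a Borel probability measure $\eta$ on $Z$, $\mathcal{P}$ is a generating partition for $G\curvearrowright(Z,\eta)$ if it is a generating partition for $G\curvearrowright Z_0$ for some $G$-invariant $\eta$-conull $Z_0\subseteq Z$. The Shannon entropy of a countable partition $\mathcal{P}$ is $H_\eta(\mathcal{P})=-\sum_{P\in\mathcal{P}}\eta(P)\log(\eta(P))$ (with $0\log 0=0$). *)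

theory Defs
  imports "HOL-Algebra.Group_Action" "HOL-Probability.Probability"
begin

text \<open>
  Groups and actions are those of HOL-Algebra. Standard Borel spaces are carried by the
  measurable space underlying a measure: only its space and its sets matter here.
  Every standard Borel space is Borel isomorphic to one whose points are real numbers, so
  quantifying existentially over standard Borel spaces may be done over type \<^typ>\<open>real measure\<close>;
  the \<open>\<sigma>\<close>-algebra of such a measure need not come from the usual topology of the reals.
\<close>

definition standard_borel :: "'a measure \<Rightarrow> bool" where
  "standard_borel M \<longleftrightarrow>
     (\<exists>T. completely_metrizable_space T \<and> separable_space T \<and> topspace T = space M \<and>
          sets M = sigma_sets (topspace T) {U. openin T U})"

definition pmp_action ::
    "('g, 'b) monoid_scheme \<Rightarrow> 'a measure \<Rightarrow> ('g \<Rightarrow> 'a \<Rightarrow> 'a) \<Rightarrow> bool" where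
  "pmp_action G M \<alpha> \<longleftrightarrow>
     standard_borel M \<and> prob_space M \<and> group_action G (space M) \<alpha> \<and>
     (\<forall>g\<in>carrier G. \<alpha> g \<in> M \<rightarrow>\<^sub>M M \<and> distr M M (\<alpha> g) = M)"

text \<open>
  As usual for measure preserving actions, freeness is a property of the action up to null sets:
  almost every point has trivial stabilizer.
\<close>

definition free_pmp_action ::
    "('g, 'b) monoid_scheme \<Rightarrow> 'a measure \<Rightarrow> ('g \<Rightarrow> 'a \<Rightarrow> 'a) \<Rightarrow> bool" where
  "free_pmp_action G M \<alpha> \<longleftrightarrow>
     pmp_action G M \<alpha> \<and> (AE x in M. stabilizer G \<alpha> x = {\<one>\<^bsub>G\<^esub>})"

definition factor_map ::
    "('g, 'b) monoid_scheme \<Rightarrow> 'a measure \<Rightarrow> ('g \<Rightarrow> 'a \<Rightarrow> 'a) \<Rightarrow>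
     'c measure \<Rightarrow> ('g \<Rightarrow> 'c \<Rightarrow> 'c) \<Rightarrow> ('a \<Rightarrow> 'c) \<Rightarrow> bool" where
  "factor_map G M \<alpha> N \<beta> f \<longleftrightarrow>
     f \<in> M \<rightarrow>\<^sub>M N \<and> distr M N f = N \<and>
     (\<forall>g\<in>carrier G. \<forall>x\<in>space M. f (\<alpha> g x) = \<beta> g (f x))"

definition invariant_sigma_algebra ::
    "('g, 'b) monoid_scheme \<Rightarrow> ('g \<Rightarrow> 'a \<Rightarrow> 'a) \<Rightarrow> 'a set \<Rightarrow> 'a set set \<Rightarrow> bool" where
  "invariant_sigma_algebra G \<alpha> \<Omega> \<S> \<longleftrightarrow>
     sigma_algebra \<Omega> \<S> \<and> (\<forall>g\<in>carrier G. \<forall>A\<in>\<S>. \<alpha> g ` A \<in> \<S>)"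

definition borel_partition :: "'a measure \<Rightarrow> 'a set set \<Rightarrow> bool" where
  "borel_partition M \<P> \<longleftrightarrow> countable \<P> \<and> \<P> \<subseteq> sets M \<and> partition_on (space M) \<P>"

definition generating_partition ::
    "('g, 'b) monoid_scheme \<Rightarrow> 'a measure \<Rightarrow> ('g \<Rightarrow> 'a \<Rightarrow> 'a) \<Rightarrow> 'a set set \<Rightarrow> bool" where
  "generating_partition G M \<alpha> \<P> \<longleftrightarrow>
     borel_partition M \<P> \<and>
     \<Inter> {\<S>. invariant_sigma_algebra G \<alpha> (space M) \<S> \<and> \<P> \<subseteq> \<S>} = sets M"

text \<open>
  The measure-theoretic version: the trace of the partition (without empty pieces, which
  \<^const>\<open>partition_on\<close> excludes) is generating on an invariant Borel set of full measure.
\<close>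

definition ae_generating_partition ::
    "('g, 'b) monoid_scheme \<Rightarrow> 'a measure \<Rightarrow> ('g \<Rightarrow> 'a \<Rightarrow> 'a) \<Rightarrow> 'a set set \<Rightarrow> bool" where
  "ae_generating_partition G M \<alpha> \<P> \<longleftrightarrow>
     borel_partition M \<P> \<and>
     (\<exists>Z\<^sub>0\<in>sets M. (AE x in M. x \<in> Z\<^sub>0) \<and> (\<forall>g\<in>carrier G. \<alpha> g ` Z\<^sub>0 = Z\<^sub>0) \<and>
        generating_partition G (restrict_space M Z\<^sub>0) \<alpha> ((\<lambda>P. P \<inter> Z\<^sub>0) ` \<P> - {{}}))"

text \<open>
  The summands are nonnegative for a probability measure; the sum is taken in the extended
  nonnegative reals because the entropy of an infinite partition may be infinite. Since
  \<^term>\<open>ln (0::real) = 0\<close>, null pieces contribute nothing.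
\<close>

definition shannon_entropy :: "'a measure \<Rightarrow> 'a set set \<Rightarrow> ennreal" where
  "shannon_entropy M \<P> = (\<Sum>\<^sub>\<infinity>P\<in>\<P>. ennreal (- (measure M P * ln (measure M P))))"

end

theory Submission
  imports Defs "HOL-Real_Asymp.Real_Asymp"
begin

text \<open>
  A measurable set \<open>A\<close> codes a point \<open>x\<close> by the function sending \<open>h\<close> to the truth value of
  \<open>h x \<in> A\<close>, an equivariant map into the shift on \<open>{0, 1}\<^sup>G\<close>. The code of \<open>x\<close> is fixed by \<open>g\<close> iff
  \<open>x\<close> lies in \<open>agree g A\<close>, the set of points with \<open>h g x \<in> A \<longleftrightarrow> h x \<in> A\<close> for all \<open>h\<close>, so the factor
  is free iff these sets are null for all \<open>g \<noteq> 1\<close>. In the measure algebra, the condition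
  \<open>\<mu>(agree g A) < \<delta>\<close> is open and dense; a Baire category argument in a small ball around the empty set
  gives \<open>A\<close> of arbitrarily small measure, hence with arbitrarily small entropy.

  For density, take a marker set \<open>B\<close> of tiny measure that meets almost every orbit. Since a
  sequence \<open>U j\<close> of measurable sets separates \<open>h x\<close> from \<open>h g x\<close>, almost every \<open>x\<close> lies outside some
  \<open>agree g (B \<inter> U j)\<close>. Hence some finite combination, modulo 2, of the sets \<open>B \<inter> U j\<close> can be added to
  \<open>A\<close> so as to cut the measure of \<open>agree g A\<close> roughly in half, and halving is iterated.
\<close>

section \<open>Small sets that code almost every point freely\<close>

text \<open>The sequence \<open>U\<close> carries what is drawn from the standard Borel structure.
  Separating a point from a finite set, not just from one other point, lets a single
  \<open>U j\<close> avoid finitely many translates of the point at once.\<close>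

locale separated_free_pmp_action = group G + group_action G "space M" \<alpha> + prob_space M
  for G (structure) and M and \<alpha> +
  fixes U :: "nat \<Rightarrow> 'c set"
  assumes countable_carrier: "countable (carrier G)"
    and infinite_carrier: "infinite (carrier G)"
    and act_measurable [measurable]: "g \<in> carrier G \<Longrightarrow> \<alpha> g \<in> M \<rightarrow>\<^sub>M M"
    and act_preserves: "g \<in> carrier G \<Longrightarrow> distr M M (\<alpha> g) = M"
    and free: "AE x in M. stabilizer G \<alpha> x = {\<one>}"
    and U_sets [measurable]: "U j \<in> sets M"
    and U_separates: "\<lbrakk>x \<in> space M; finite K; x \<notin> K\<rbrakk> \<Longrightarrow> \<exists>j. x \<in> U j \<and> U j \<inter> K = {}"
begin

section \<open>Agreement sets and their upper semicontinuity\<close>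

definition agree :: "'a \<Rightarrow> 'c set \<Rightarrow> 'c set" where
  "agree g A = {x \<in> space M. \<forall>h\<in>carrier G. \<alpha> h (\<alpha> g x) \<in> A \<longleftrightarrow> \<alpha> h x \<in> A}"

lemma act_space: "g \<in> carrier G \<Longrightarrow> x \<in> space M \<Longrightarrow> \<alpha> g x \<in> space M"
  using element_image by blast

lemma prob_vimage_act:
  assumes "g \<in> carrier G" "A \<in> sets M"
  shows "prob (\<alpha> g -` A \<inter> space M) = prob A"
  using measure_distr[of "\<alpha> g" M M A] assms act_measurable act_preserves by simp

lemma vimage_act_sets:
  assumes "g \<in> carrier G" "A \<in> sets M"
  shows "\<alpha> g -` A \<inter> space M \<in> sets M"
  using measurable_sets[OF act_measurable[OF assms(1)] assms(2)] .

text \<open>The index set \<open>I\<close> is left free: the whole group gives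
  \<open>agree g A\<close>, finite sets give its outer approximations.\<close>

lemma sets_agree_on:
  assumes "g \<in> carrier G" "A \<in> sets M" "I \<subseteq> carrier G"
  shows "{x \<in> space M. \<forall>h\<in>I. \<alpha> h (\<alpha> g x) \<in> A \<longleftrightarrow> \<alpha> h x \<in> A} \<in> sets M"
proof (rule sets.sets_Collect_countable_All')
  show "countable I" using assms(3) countable_carrier countable_subset by blast
  fix h assume "h \<in> I"
  then have [measurable]: "\<alpha> h \<in> M \<rightarrow>\<^sub>M M" "\<alpha> g \<in> M \<rightarrow>\<^sub>M M" "A \<in> sets M"
    using assms act_measurable by auto
  show "{x \<in> space M. \<alpha> h (\<alpha> g x) \<in> A \<longleftrightarrow> \<alpha> h x \<in> A} \<in> sets M"
    by measurable
qed

lemma sets_agree: "g \<in> carrier G \<Longrightarrow> A \<in> sets M \<Longrightarrow> agree g A \<in> sets M"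
  unfolding agree_def by (rule sets_agree_on) auto

text \<open>\<open>agree g A\<close> is a decreasing intersection of sets \<open>E n\<close> that
  test only finitely many \<open>h\<close>. One \<open>E n\<close> is already close to it in
  measure, and a small change of \<open>A\<close> affects finitely many tests only slightly.\<close>

lemma agree_upper_semicontinuous:
  assumes g: "g \<in> carrier G" and A: "A \<in> sets M" and "\<gamma> > 0"
  obtains \<tau> where "\<tau> > 0"
    "\<And>B. B \<in> sets M \<Longrightarrow> prob (sym_diff A B) < \<tau> \<Longrightarrow> prob (agree g B - agree g A) < \<gamma>"
proof -
  define e where "e = from_nat_into (carrier G)"
  have e: "range e = carrier G"
    unfolding e_def using countable_carrier infinite_carrier by (intro range_from_nat_into) auto
  define E where "E n = {x \<in> space M. \<forall>h\<in>e ` {..n}. \<alpha> h (\<alpha> g x) \<in> A \<longleftrightarrow> \<alpha> h x \<in> A}" for n :: nat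
  have E_sets: "E n \<in> sets M" for n
    unfolding E_def by (rule sets_agree_on) (use g A e in auto)
  have "(\<Inter>n. E n) = agree g A"
    unfolding E_def agree_def e[symmetric] by auto
  moreover have "decseq E"
    unfolding decseq_def
  proof safe
    fix m n x assume "m \<le> n" "x \<in> E n"
    moreover have "e ` {..m} \<subseteq> e ` {..n}" using \<open>m \<le> n\<close> by auto
    ultimately show "x \<in> E m" unfolding E_def by blast
  qed
  ultimately have "(\<lambda>n. prob (E n)) \<longlonglongrightarrow> prob (agree g A)"
    using finite_Lim_measure_decseq[of E] E_sets by auto
  moreover have "prob (agree g A) < prob (agree g A) + \<gamma> / 2" using \<open>\<gamma> > 0\<close> by simp
  ultimately have "eventually (\<lambda>n. prob (E n) < prob (agree g A) + \<gamma> / 2) sequentially"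
    by (rule order_tendstoD(2))
  then obtain n where n: "prob (E n) < prob (agree g A) + \<gamma> / 2"
    by (auto simp: eventually_sequentially)
  have "agree g A \<subseteq> E n"
    using e unfolding agree_def E_def by auto
  then have diff: "prob (E n - agree g A) < \<gamma> / 2"
    using n finite_measure_Diff[OF E_sets sets_agree[OF g A]] by simp
  \<comment> \<open>Each of the \<open>n + 1\<close> tests reads \<open>A\<close> at two points, so
    passing to \<open>B\<close> costs at most \<open>2 * (n + 1)\<close> times the distance; this
    radius keeps the cost below \<open>\<gamma> / 2\<close>.\<close>
  show ?thesis
  proof (rule that[of "\<gamma> / (4 * (real n + 1))"])
    show "\<gamma> / (4 * (real n + 1)) > 0" using \<open>\<gamma> > 0\<close> by simp
    fix B assume B: "B \<in> sets M" and lt: "prob (sym_diff A B) < \<gamma> / (4 * (real n + 1))"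
    \<comment> \<open>\<open>P h\<close> and \<open>Q h\<close> collect the points \<open>x\<close>
      for which \<open>A\<close> and \<open>B\<close> differ at \<open>h x\<close> and at
      \<open>h g x\<close> respectively. Both have the measure of \<open>sym_diff A B\<close> by
      invariance.\<close>
    define P where "P h = \<alpha> h -` sym_diff A B \<inter> space M" for h
    define Q where "Q h = \<alpha> g -` P h \<inter> space M" for h
    have D: "sym_diff A B \<in> sets M" using A B by auto
    have PQ: "P h \<in> sets M" "Q h \<in> sets M" "prob (P h) = prob (sym_diff A B)"
        "prob (Q h) = prob (sym_diff A B)"
      if "h \<in> carrier G" for h
    proof -
      show 1: "prob (P h) = prob (sym_diff A B)" "P h \<in> sets M"
        unfolding P_def using prob_vimage_act[OF that D] vimage_act_sets[OF that D] .
      show "Q h \<in> sets M" "prob (Q h) = prob (sym_diff A B)"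
        unfolding Q_def using 1 g prob_vimage_act vimage_act_sets by auto
    qed
    have ei: "e i \<in> carrier G" for i using e by auto
    have "agree g B - agree g A \<subseteq> (E n - agree g A) \<union> (\<Union>i\<in>{..n}. P (e i) \<union> Q (e i))"
    proof
      fix x assume x: "x \<in> agree g B - agree g A"
      then have xM: "x \<in> space M" unfolding agree_def by blast
      show "x \<in> (E n - agree g A) \<union> (\<Union>i\<in>{..n}. P (e i) \<union> Q (e i))"
      proof (cases "x \<in> E n")
        case False
        then obtain i where i: "i \<le> n" "(\<alpha> (e i) (\<alpha> g x) \<in> A) \<noteq> (\<alpha> (e i) x \<in> A)"
          using xM unfolding E_def by blast
        have "(\<alpha> (e i) (\<alpha> g x) \<in> B) = (\<alpha> (e i) x \<in> B)"
          using x ei unfolding agree_def by blast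
        then have "\<alpha> (e i) (\<alpha> g x) \<in> sym_diff A B \<or> \<alpha> (e i) x \<in> sym_diff A B"
          using i(2) by blast
        then have "x \<in> P (e i) \<union> Q (e i)"
          using xM act_space[OF g xM] unfolding P_def Q_def by blast
        then show ?thesis using i(1) by blast
      qed (use x in blast)
    qed
    then have "prob (agree g B - agree g A) \<le> prob ((E n - agree g A) \<union> (\<Union>i\<in>{..n}. P (e i) \<union> Q (e i)))"
      using E_sets sets_agree g A PQ ei by (intro finite_measure_mono sets.Un sets.finite_UN) auto
    also have "\<dots> \<le> prob (E n - agree g A) + prob (\<Union>i\<in>{..n}. P (e i) \<union> Q (e i))"
      using E_sets sets_agree g A PQ ei by (intro measure_Un_le sets.finite_UN) auto
    also have "prob (\<Union>i\<in>{..n}. P (e i) \<union> Q (e i)) \<le> (\<Sum>i\<in>{..n}. prob (P (e i) \<union> Q (e i)))"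
      using PQ ei by (intro measure_UNION_le) auto
    also have "\<dots> \<le> (\<Sum>i\<in>{..n}. 2 * prob (sym_diff A B))"
    proof (rule sum_mono)
      fix i
      show "prob (P (e i) \<union> Q (e i)) \<le> 2 * prob (sym_diff A B)"
        using measure_Un_le[of "P (e i)" M "Q (e i)"] PQ[OF ei] by simp
    qed
    also have "\<dots> = 2 * (real n + 1) * prob (sym_diff A B)" by simp
    also have "\<dots> < \<gamma> / 2" using lt by (simp add: field_simps)
    finally show "prob (agree g B - agree g A) < \<gamma>" using diff by simp
  qed
qed

section \<open>Halving by finite combinations modulo 2\<close>

text \<open>At a point where some \<open>B j\<close> fails to agree, at most half of the sums modulo
  2 of the \<open>B j\<close> agree. The induction turns this average into one choice: inside
  \<open>?F\<close> adding \<open>B n\<close> does not affect agreement, so the choice made there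
  for smaller \<open>n\<close> survives, while outside \<open>?F\<close> adding \<open>B n\<close>
  or not is decided by which option is better.\<close>

lemma agree_halving_finite:
  fixes n :: nat
  assumes g: "g \<in> carrier G" and B: "\<And>j. B j \<in> sets M"
    and sub: "\<And>j. B j \<subseteq> C"
    and Q: "Q \<in> sets M"
  shows "\<exists>S\<in>sets M. S \<subseteq> C \<and> prob (Q \<inter> agree g S - (\<Inter>j<n. agree g (B j))) \<le> prob Q / 2"
  using Q
proof (induction n arbitrary: Q)
  case 0
  \<comment> \<open>The empty intersection is the whole type, so nothing is left to bound.\<close>
  show ?case by (rule bexI[of _ "{}"]) auto
next
  case (Suc n)
  let ?W = "\<Inter>j<n. agree g (B j)" and ?F = "agree g (B n)"
  have F: "?F \<in> sets M" using sets_agree[OF g B] .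
  have W: "(\<Inter>j<Suc n. agree g (B j)) = ?W \<inter> ?F" by (auto simp: lessThan_Suc)
  have WF: "?W \<inter> ?F \<in> sets M"
    unfolding W[symmetric] by (intro sets.finite_INT) (auto simp: sets_agree[OF g B])
  from Suc.IH[of "Q \<inter> ?F"] Suc.prems F obtain S where
    S: "S \<in> sets M" "S \<subseteq> C" "prob (Q \<inter> ?F \<inter> agree g S - ?W) \<le> prob (Q \<inter> ?F) / 2" by auto
  \<comment> \<open>A point off \<open>?F\<close> cannot lie in both \<open>agree g S\<close> and \<open>agree g (sym_diff S (B n))\<close>; one of the two sets wins half.\<close>
  have cases_S: "\<exists>S'\<in>sets M. S' \<subseteq> C \<and> ?F \<inter> agree g S' = ?F \<inter> agree g S \<and>
      prob ((Q - ?F) \<inter> agree g S') \<le> prob (Q - ?F) / 2"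
  proof -
    define T where "T = sym_diff S (B n)"
    have T: "T \<in> sets M" "T \<subseteq> C" using S B sub unfolding T_def by auto
    have TF: "?F \<inter> agree g T = ?F \<inter> agree g S"
      unfolding agree_def T_def by auto
    have disj: "agree g S \<inter> agree g T \<subseteq> ?F"
      unfolding agree_def T_def by auto
    have "prob ((Q - ?F) \<inter> agree g S) + prob ((Q - ?F) \<inter> agree g T)
        = prob ((Q - ?F) \<inter> agree g S \<union> (Q - ?F) \<inter> agree g T)"
      using disj Suc.prems F S T sets_agree g
      by (intro finite_measure_Union[symmetric]) auto
    also have "\<dots> \<le> prob (Q - ?F)" using Suc.prems F by (intro finite_measure_mono) auto
    finally have "prob ((Q - ?F) \<inter> agree g S) \<le> prob (Q - ?F) / 2
        \<or> prob ((Q - ?F) \<inter> agree g T) \<le> prob (Q - ?F) / 2" by linarith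
    then show ?thesis using S T TF by blast
  qed
  then obtain S' where S': "S' \<in> sets M" "S' \<subseteq> C" "?F \<inter> agree g S' = ?F \<inter> agree g S"
    "prob ((Q - ?F) \<inter> agree g S') \<le> prob (Q - ?F) / 2" by blast
  have "Q \<inter> agree g S' - (?W \<inter> ?F) = (Q \<inter> agree g S' \<inter> ?F - ?W \<inter> ?F) \<union> ((Q - ?F) \<inter> agree g S')"
    by auto
  also have "Q \<inter> agree g S' \<inter> ?F - ?W \<inter> ?F = Q \<inter> ?F \<inter> agree g S - ?W"
    using S'(3) by auto
  finally have eq: "Q \<inter> agree g S' - (?W \<inter> ?F) = (Q \<inter> ?F \<inter> agree g S - ?W) \<union> ((Q - ?F) \<inter> agree g S')" .
  \<comment> \<open>For \<open>n = 0\<close> the set \<open>?W\<close> is the whole type and need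
    not be measurable; \<open>?W \<inter> ?F\<close> always is.\<close>
  have "Q \<inter> ?F \<inter> agree g S - ?W = Q \<inter> ?F \<inter> agree g S - ?W \<inter> ?F" by auto
  also have "\<dots> \<in> sets M" using Suc.prems F WF sets_agree[OF g S(1)] by auto
  finally have m: "Q \<inter> ?F \<inter> agree g S - ?W \<in> sets M" .
  have "prob (Q \<inter> agree g S' - (?W \<inter> ?F)) \<le> prob (Q \<inter> ?F) / 2 + prob (Q - ?F) / 2"
    unfolding eq using S(3) S'(4)
      measure_Un_le[OF m, of "(Q - ?F) \<inter> agree g S'"] Suc.prems F sets_agree[OF g S'(1)]
    by simp
  also have "\<dots> = prob Q / 2"
    using finite_measure_Union[of "Q \<inter> ?F" "Q - ?F"] Suc.prems F
    by (simp add: Int_Diff_Un Int_Diff_disjoint)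
  finally show ?case unfolding W using S' by auto
qed

section \<open>Markers of small measure\<close>

lemma act_mult: "x \<in> space M \<Longrightarrow> g \<in> carrier G \<Longrightarrow> h \<in> carrier G \<Longrightarrow> \<alpha> (g \<otimes> h) x = \<alpha> g (\<alpha> h x)"
  by (rule composition_rule)

lemma act_one: "x \<in> space M \<Longrightarrow> \<alpha> \<one> x = x"
  using id_eq_one by (metis restrict_apply')

lemma act_inv: "x \<in> space M \<Longrightarrow> g \<in> carrier G \<Longrightarrow> \<alpha> (inv g) (\<alpha> g x) = x"
  by (simp add: orbit_sym_aux)

text \<open>If no element of \<open>B\<close> is moved into \<open>B\<close> by a quotient of two
  distinct elements of \<open>D\<close>, then the preimages of \<open>B\<close> under the
  \<open>n\<close> elements of \<open>D\<close> are disjoint and of equal measure, so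
  \<open>prob B \<le> 1 / n\<close>. Such a \<open>B\<close> is glued from the sets
  \<open>V k\<close>, which have this property one by one.\<close>

lemma small_marker:
  assumes "\<eta> > 0"
  obtains B where "B \<in> sets M" "prob B < \<eta>" "AE x in M. \<exists>h\<in>carrier G. \<alpha> h x \<in> B"
proof -
  obtain n :: nat where n: "n > 0" "1 / real n < \<eta>"
    using assms nat_approx_posE by (metis zero_less_Suc)
  obtain D where D: "finite D" "card D = n" "D \<subseteq> carrier G"
    using infinite_arbitrarily_large[OF infinite_carrier, of n] by blast
  \<comment> \<open>If \<open>d x\<close> and \<open>d' x\<close> both lie in \<open>B\<close>, then
    \<open>d' \<otimes> inv d\<close> maps the first to the second.\<close>
  define E where "E = {d' \<otimes> inv d | d d'. d \<in> D \<and> d' \<in> D \<and> d \<noteq> d'}"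
  have finE: "finite E"
  proof (rule finite_subset)
    show "E \<subseteq> (\<lambda>(d, d'). d' \<otimes> inv d) ` (D \<times> D)" unfolding E_def by force
  qed (use D(1) in blast)
  have E: "E \<subseteq> carrier G" "\<one> \<notin> E"
  proof -
    have "d' \<otimes> inv d \<in> carrier G" if "d \<in> D" "d' \<in> D" for d d'
      by (intro m_closed inv_closed subsetD[OF D(3)] that)
    then show "E \<subseteq> carrier G" unfolding E_def by blast
    show "\<one> \<notin> E"
    proof
      assume "\<one> \<in> E"
      then obtain d d' where d: "d \<in> D" "d' \<in> D" "d \<noteq> d'" "\<one> = d' \<otimes> inv d"
        unfolding E_def by blast
      have "d \<in> carrier G" "d' \<in> carrier G" using d D(3) by auto
      then have "\<one> \<otimes> d = d'"
        unfolding d(4) by (simp add: m_assoc)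
      then show False using d(3) \<open>d \<in> carrier G\<close> by simp
    qed
  qed
  define V where "V k = {y \<in> space M. y \<in> U k \<and> (\<forall>e\<in>E. \<alpha> e y \<notin> U k)}" for k
  define W where "W k = {x \<in> space M. \<exists>h\<in>carrier G. \<alpha> h x \<in> V k}" for k
  \<comment> \<open>\<open>W k\<close> is the union of the orbits that meet \<open>V k\<close>. Each
    orbit contributes to \<open>B\<close> only through the first \<open>V k\<close> that it
    meets.\<close>
  define B where "B = (\<Union>k. V k - (\<Union>i<k. W i))"
  have V_sets [measurable]: "V k \<in> sets M" for k
  proof -
    have "V k = U k - (\<Union>e\<in>E. \<alpha> e -` U k \<inter> space M)"
      unfolding V_def using sets.sets_into_space[OF U_sets] by auto
    also have "\<dots> \<in> sets M"
      using finE E vimage_act_sets by (intro sets.Diff sets.finite_UN) auto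
    finally show ?thesis .
  qed
  have W_sets: "W k \<in> sets M" for k
  proof -
    have "W k = (\<Union>h\<in>carrier G. \<alpha> h -` V k \<inter> space M)"
      unfolding W_def by auto
    also have "\<dots> \<in> sets M"
      using countable_carrier vimage_act_sets V_sets by (intro sets.countable_UN') auto
    finally show ?thesis .
  qed
  have B_sets: "B \<in> sets M"
    unfolding B_def using V_sets W_sets by (intro sets.countable_UN') auto
  have B_space: "B \<subseteq> space M" using sets.sets_into_space[OF B_sets] .
  \<comment> \<open>Two points of \<open>B\<close> in one orbit lie in the same \<open>V k\<close>, the first one that the orbit meets.\<close>
  have B_sep: "\<alpha> e y \<notin> B" if y: "y \<in> B" and e: "e \<in> E" for e y
  proof
    assume "\<alpha> e y \<in> B"
    then obtain k' where k': "\<alpha> e y \<in> V k'" "\<alpha> e y \<notin> (\<Union>i<k'. W i)" unfolding B_def by blast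
    obtain k where k: "y \<in> V k" "y \<notin> (\<Union>i<k. W i)" using y unfolding B_def by blast
    have ec: "e \<in> carrier G" and ys: "y \<in> space M" using e E y B_space by auto
    have "\<alpha> (inv e) (\<alpha> e y) = y" using act_inv[OF ys ec] .
    then have "\<alpha> e y \<in> W k"
      unfolding W_def using k(1) act_space[OF ec ys] inv_closed[OF ec] by force
    moreover have "y \<in> W k'"
      unfolding W_def using k'(1) ec ys by blast
    ultimately have "k = k'" using k(2) k'(2) by (metis UN_I lessThan_iff linorder_neqE_nat)
    then show False using k(1) k'(1) e unfolding V_def by blast
  qed
  have "real n * prob B = (\<Sum>d\<in>D. prob (\<alpha> d -` B \<inter> space M))"
    using D prob_vimage_act[OF _ B_sets] by (simp add: subset_iff)
  also have "\<dots> = prob (\<Union>d\<in>D. \<alpha> d -` B \<inter> space M)"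
  proof (rule finite_measure_finite_Union[symmetric])
    show "(\<lambda>d. \<alpha> d -` B \<inter> space M) ` D \<subseteq> sets M" using D(3) vimage_act_sets B_sets by auto
    show "disjoint_family_on (\<lambda>d. \<alpha> d -` B \<inter> space M) D"
      unfolding disjoint_family_on_def
    proof (intro ballI impI)
      fix d d' assume d: "d \<in> D" "d' \<in> D" "d \<noteq> d'"
      then have dc: "d \<in> carrier G" "d' \<in> carrier G" using D(3) by auto
      have "d' \<otimes> inv d \<in> E" unfolding E_def using d by blast
      moreover have "\<alpha> (d' \<otimes> inv d) (\<alpha> d x) = \<alpha> d' x" if "x \<in> space M" for x
        using dc that by (simp add: act_mult act_inv act_space)
      ultimately show "(\<alpha> d -` B \<inter> space M) \<inter> (\<alpha> d' -` B \<inter> space M) = {}"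
        using B_sep by fastforce
    qed
  qed (fact D(1))
  also have "\<dots> \<le> 1" by simp
  finally have "prob B \<le> 1 / real n" using n(1) by (simp add: field_simps)
  moreover have "AE x in M. \<exists>h\<in>carrier G. \<alpha> h x \<in> B"
    using free AE_space
  proof eventually_elim
    case (elim x)
    \<comment> \<open>With trivial stabilizer, \<open>x\<close> differs from its finitely many
      translates by \<open>E\<close>, so some \<open>U j\<close> isolates it from them and
      \<open>x\<close> lies in \<open>V j\<close>.\<close>
    have "x \<notin> (\<lambda>e. \<alpha> e x) ` E"
      using elim(1) E unfolding stabilizer_def by force
    then obtain j where "x \<in> U j" "U j \<inter> (\<lambda>e. \<alpha> e x) ` E = {}"
      using U_separates[OF elim(2)] finE by blast
    then have "x \<in> V j" unfolding V_def using elim(2) by blast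
    then have "x \<in> W j" unfolding W_def using act_one elim(2) by force
    define k where "k = (LEAST k. x \<in> W k)"
    have k: "x \<in> W k" "i < k \<Longrightarrow> x \<notin> W i" for i
      unfolding k_def using LeastI[of "\<lambda>k. x \<in> W k", OF \<open>x \<in> W j\<close>] not_less_Least by blast+
    then obtain h where h: "h \<in> carrier G" "\<alpha> h x \<in> V k" unfolding W_def by blast
    \<comment> \<open>The sets \<open>W i\<close> are invariant, so minimality of \<open>k\<close>
      for \<open>x\<close> passes to \<open>h x\<close>.\<close>
    have "\<alpha> h x \<notin> W i" if "i < k" for i
    proof
      assume "\<alpha> h x \<in> W i"
      then obtain h' where "h' \<in> carrier G" "\<alpha> h' (\<alpha> h x) \<in> V i" unfolding W_def by blast
      then have "x \<in> W i" unfolding W_def using h(1) elim(2) by (auto simp: act_mult[symmetric])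
      then show False using k(2)[OF that] by simp
    qed
    then have "\<alpha> h x \<in> B" unfolding B_def using h(2) by blast
    then show ?case using h(1) by blast
  qed
  ultimately show ?thesis using that[of B] B_sets n(2) by linarith
qed

section \<open>Density: making the agreement set small\<close>

text \<open>The change \<open>S\<close> lies in a tiny marker set, so upper semicontinuity bounds
  the points that newly agree by \<open>\<gamma> / 2\<close>. Points that agreed before still agree
  only if \<open>S\<close> agrees there, which the finite halving allows on at most half of them, up
  to the small set \<open>I n\<close>.\<close>

lemma agree_halving:
  assumes g: "g \<in> carrier G" "g \<noteq> \<one>" and A: "A \<in> sets M" and pos: "\<tau> > 0" "\<gamma> > 0"
  obtains A' where "A' \<in> sets M" "prob (sym_diff A A') < \<tau>"
    "prob (agree g A') \<le> prob (agree g A) / 2 + \<gamma>"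
proof -
  obtain \<tau>' where \<tau>': "\<tau>' > 0"
    "\<And>B. B \<in> sets M \<Longrightarrow> prob (sym_diff A B) < \<tau>' \<Longrightarrow> prob (agree g B - agree g A) < \<gamma> / 2"
    using agree_upper_semicontinuous[OF g(1) A, of "\<gamma> / 2"] pos by auto
  obtain B where B: "B \<in> sets M" "prob B < min \<tau> \<tau>'" "AE x in M. \<exists>h\<in>carrier G. \<alpha> h x \<in> B"
    using small_marker[of "min \<tau> \<tau>'"] pos \<tau>'(1) by auto
  \<comment> \<open>With \<open>Suc n\<close> the intersection is never empty-indexed, so every
    \<open>I n\<close> is a measurable set.\<close>
  define I where "I n = (\<Inter>j<Suc n. agree g (B \<inter> U j))" for n
  have BU: "B \<inter> U j \<in> sets M" for j using B(1) by simp
  have I_sets: "I n \<in> sets M" for n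
    unfolding I_def by (intro sets.finite_INT) (auto intro: sets_agree[OF g(1) BU])
  have "AE x in M. x \<notin> (\<Inter>n. I n)"
    using free B(3) AE_space
  proof eventually_elim
    case (elim x)
    then obtain h where h: "h \<in> carrier G" "\<alpha> h x \<in> B" by blast
    have gx: "\<alpha> g x \<in> space M" "\<alpha> g x \<noteq> x"
      using elim g act_space unfolding stabilizer_def by auto
    \<comment> \<open>Since \<open>g\<close> moves \<open>x\<close> and \<open>h\<close> acts
      injectively, some \<open>U j\<close> contains \<open>h x\<close> but not \<open>h g x\<close>.
      As \<open>h x\<close> is also in \<open>B\<close>, the set \<open>B \<inter> U j\<close> tells
      the two apart.\<close>
    have "\<alpha> h x \<notin> {\<alpha> h (\<alpha> g x)}"
      using gx(2) inj_onD[OF inj_prop[OF h(1)] _ elim(3) gx(1)] by auto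
    then obtain j where "\<alpha> h x \<in> U j" "U j \<inter> {\<alpha> h (\<alpha> g x)} = {}"
      using U_separates[OF act_space[OF h(1) elim(3)], of "{\<alpha> h (\<alpha> g x)}"] by blast
    then have "x \<notin> agree g (B \<inter> U j)" unfolding agree_def using h by blast
    then show ?case unfolding I_def by blast
  qed
  then have "prob (\<Inter>n. I n) = 0"
    using I_sets by (subst prob_eq_0) auto
  moreover have "decseq I" unfolding I_def decseq_def by auto
  ultimately have "(\<lambda>n. prob (I n)) \<longlonglongrightarrow> 0"
    using finite_Lim_measure_decseq[of I] I_sets by auto
  then have "eventually (\<lambda>n. prob (I n) < \<gamma> / 2) sequentially"
    using order_tendstoD(2)[of _ 0 sequentially "\<gamma> / 2"] pos by simp
  then obtain n where n: "prob (I n) < \<gamma> / 2" by (auto simp: eventually_sequentially)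
  obtain S where S: "S \<in> sets M" "S \<subseteq> B" "prob (agree g A \<inter> agree g S - I n) \<le> prob (agree g A) / 2"
    using agree_halving_finite[of g "\<lambda>j. B \<inter> U j" B "agree g A" "Suc n"] g(1) BU sets_agree[OF g(1) A]
    unfolding I_def by blast
  define A' where "A' = sym_diff A S"
  have A': "A' \<in> sets M" using A S(1) unfolding A'_def by auto
  have sd: "sym_diff A A' = S" unfolding A'_def by auto
  have S_small: "prob S < min \<tau> \<tau>'"
    using finite_measure_mono[OF S(2) B(1)] B(2) by simp
  have near: "prob (agree g A' - agree g A) < \<gamma> / 2"
  proof (rule \<tau>'(2)[OF A'])
    show "prob (sym_diff A A') < \<tau>'" unfolding sd using S_small by simp
  qed
  have meas: "agree g A \<in> sets M" "agree g A' \<in> sets M" "agree g S \<in> sets M"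
    using sets_agree[OF g(1)] A A' S(1) by auto
  \<comment> \<open>Where \<open>A\<close> agrees, the sum modulo 2 of \<open>A\<close> and
    \<open>S\<close> agrees exactly when \<open>S\<close> does.\<close>
  have "agree g A' \<subseteq> (agree g A' - agree g A) \<union> ((agree g A \<inter> agree g S - I n) \<union> I n)"
    unfolding A'_def by (auto simp: agree_def)
  then have "prob (agree g A') \<le> prob ((agree g A' - agree g A) \<union> ((agree g A \<inter> agree g S - I n) \<union> I n))"
    using meas I_sets by (intro finite_measure_mono) auto
  also have "\<dots> \<le> prob (agree g A' - agree g A) + prob ((agree g A \<inter> agree g S - I n) \<union> I n)"
    using meas I_sets by (intro measure_Un_le) auto
  also have "prob ((agree g A \<inter> agree g S - I n) \<union> I n) \<le> prob (agree g A \<inter> agree g S - I n) + prob (I n)"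
    using meas I_sets by (intro measure_Un_le) auto
  finally have "prob (agree g A') \<le> prob (agree g A) / 2 + \<gamma>" using near n S(3) by linarith
  moreover have "prob (sym_diff A A') < \<tau>" unfolding sd using S_small by simp
  ultimately show ?thesis using that A' by blast
qed

lemma prob_sym_diff_triangle:
  assumes "A \<in> sets M" "B \<in> sets M" "C \<in> sets M"
  shows "prob (sym_diff A C) \<le> prob (sym_diff A B) + prob (sym_diff B C)"
proof -
  have "prob (sym_diff A C) \<le> prob (sym_diff A B \<union> sym_diff B C)"
    using assms by (intro finite_measure_mono) auto
  also have "\<dots> \<le> prob (sym_diff A B) + prob (sym_diff B C)"
    using assms by (intro measure_Un_le) auto
  finally show ?thesis .
qed

text \<open>The map sending \<open>t\<close> to \<open>t / 2 + \<gamma>\<close> has fixed point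
  \<open>2 * \<gamma>\<close>, so the excess over it halves at each step. The distance budget
  \<open>\<tau>\<close> is shared equally between the earlier steps and the last one.\<close>

lemma agree_iterated_halving:
  assumes g: "g \<in> carrier G" "g \<noteq> \<one>" and A: "A \<in> sets M" and \<gamma>: "\<gamma> > 0" and "\<tau> > 0"
  shows "\<exists>A'\<in>sets M. prob (sym_diff A A') < \<tau> \<and> prob (agree g A') \<le> (1/2) ^ k + 2 * \<gamma>"
  using \<open>\<tau> > 0\<close>
proof (induction k arbitrary: \<tau>)
  case 0
  show ?case
    by (rule bexI[OF _ A]) (use 0 \<gamma> in \<open>auto intro!: order_trans[OF prob_le_1]\<close>)
next
  case (Suc k)
  obtain A' where A': "A' \<in> sets M" "prob (sym_diff A A') < \<tau> / 2"
    "prob (agree g A') \<le> (1/2) ^ k + 2 * \<gamma>"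
    using Suc.IH[of "\<tau> / 2"] Suc.prems by auto
  obtain A'' where A'': "A'' \<in> sets M" "prob (sym_diff A' A'') < \<tau> / 2"
    "prob (agree g A'') \<le> prob (agree g A') / 2 + \<gamma>"
    using agree_halving[OF g A'(1), of "\<tau> / 2" \<gamma>] \<gamma> Suc.prems by auto
  show ?case
  proof (intro bexI conjI)
    show "prob (sym_diff A A'') < \<tau>"
      using prob_sym_diff_triangle[OF A A'(1) A''(1)] A'(2) A''(2) by linarith
    show "prob (agree g A'') \<le> (1/2) ^ Suc k + 2 * \<gamma>"
      using A''(3) A'(3) by simp
  qed (fact A''(1))
qed

text \<open>Density comes from iterated halving and openness from upper semicontinuity. The radii
  \<open>\<tau> / 4\<close> and \<open>\<tau> / 2\<close> are chosen to feed the nested construction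
  of \<open>limit_set\<close>.\<close>

lemma agree_open_dense:
  assumes g: "g \<in> carrier G" "g \<noteq> \<one>" and A: "A \<in> sets M" and "\<tau> > 0" "\<delta> > 0"
  obtains A' \<tau>' where "A' \<in> sets M" "prob (sym_diff A A') < \<tau> / 4" "\<tau>' > 0" "\<tau>' \<le> \<tau> / 2"
    "\<And>B. B \<in> sets M \<Longrightarrow> prob (sym_diff A' B) < \<tau>' \<Longrightarrow> prob (agree g B) < \<delta>"
proof -
  \<comment> \<open>The bound for \<open>agree g A'\<close> becomes less than
    \<open>\<delta> / 4 + \<delta> / 4\<close>, leaving \<open>\<delta> / 2\<close> for the points
    gained in passing to \<open>B\<close>.\<close>
  obtain k where k: "(1/2::real) ^ k < \<delta> / 4"
    using real_arch_pow_inv[of "\<delta> / 4" "1/2"] \<open>\<delta> > 0\<close> by auto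
  obtain A' where A': "A' \<in> sets M" "prob (sym_diff A A') < \<tau> / 4"
    "prob (agree g A') \<le> (1/2) ^ k + 2 * (\<delta> / 8)"
    using agree_iterated_halving[OF g A, of "\<delta> / 8" "\<tau> / 4" k] \<open>\<delta> > 0\<close> \<open>\<tau> > 0\<close> by auto
  obtain \<tau>' where \<tau>': "\<tau>' > 0"
    "\<And>B. B \<in> sets M \<Longrightarrow> prob (sym_diff A' B) < \<tau>' \<Longrightarrow> prob (agree g B - agree g A') < \<delta> / 2"
    using agree_upper_semicontinuous[OF g(1) A'(1), of "\<delta> / 2"] \<open>\<delta> > 0\<close> by auto
  show ?thesis
  proof (rule that[OF A'(1,2), of "min \<tau>' (\<tau> / 2)"])
    fix B assume B: "B \<in> sets M" "prob (sym_diff A' B) < min \<tau>' (\<tau> / 2)"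
    have "prob (agree g B) \<le> prob ((agree g B - agree g A') \<union> agree g A')"
      using sets_agree[OF g(1)] B A' by (intro finite_measure_mono) auto
    also have "\<dots> \<le> prob (agree g B - agree g A') + prob (agree g A')"
      using sets_agree[OF g(1)] B A' by (intro measure_Un_le) auto
    also have "prob (agree g B - agree g A') < \<delta> / 2" using \<tau>'(2) B by simp
    finally show "prob (agree g B) < \<delta>" using A'(3) k by linarith
  qed (use \<tau>'(1) \<open>\<tau> > 0\<close> in auto)
qed

section \<open>Baire category in the measure algebra\<close>

text \<open>This is completeness of the measure algebra. The later steps after \<open>n\<close> sum
  to at most \<open>\<tau> n / 4 * 2\<close>, so the limit stays inside every ball of the
  sequence.\<close>

lemma limit_set:
  assumes A: "\<And>n. A n \<in> sets M" and \<tau>: "\<And>n. \<tau> n > 0" "\<And>n. \<tau> (Suc n) \<le> \<tau> n / 2"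
    and step: "\<And>n. prob (sym_diff (A n) (A (Suc n))) < \<tau> n / 4"
  obtains B where "B \<in> sets M" "\<And>n. prob (sym_diff (A n) B) < \<tau> n"
proof
  \<comment> \<open>The lower limit of the sequence: a point outside all differences
    \<open>D i\<close> has constant membership from \<open>n\<close> on, so \<open>B\<close> and
    \<open>A n\<close> treat it alike.\<close>
  define B where "B = (\<Union>N. \<Inter>n\<in>{N..}. A n)"
  show B_sets: "B \<in> sets M"
    unfolding B_def using A by (intro sets.countable_UN' sets.countable_INT') auto
  fix n
  define D where "D i = sym_diff (A (n + i)) (A (Suc (n + i)))" for i
  have cover: "sym_diff (A n) B \<subseteq> (\<Union>i. D i)"
  proof
    fix x assume x: "x \<in> sym_diff (A n) B"
    show "x \<in> (\<Union>i. D i)"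
    proof (rule ccontr)
      assume not: "x \<notin> (\<Union>i. D i)"
      have const: "x \<in> A (n + i) \<longleftrightarrow> x \<in> A n" for i
        by (induction i) (use not in \<open>auto simp: D_def\<close>)
      have "x \<in> B \<longleftrightarrow> x \<in> A n"
      proof
        assume "x \<in> B"
        then obtain N where "\<And>m. m \<ge> N \<Longrightarrow> x \<in> A m" unfolding B_def by auto
        then have "x \<in> A (n + N)" by simp
        then show "x \<in> A n" using const by blast
      next
        assume "x \<in> A n"
        then have "x \<in> A m" if "m \<ge> n" for m using const[of "m - n"] that by simp
        then show "x \<in> B" unfolding B_def by auto
      qed
      then show False using x by blast
    qed
  qed
  have D_sets: "range D \<subseteq> sets M" unfolding D_def using A by auto
  have bound: "prob (D i) \<le> \<tau> n / 4 * (1/2) ^ i" for i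
  proof -
    have "\<tau> (n + i) \<le> \<tau> n * (1/2) ^ i"
    proof (induction i)
      case (Suc i)
      then show ?case using \<tau>(2)[of "n + i"] by simp
    qed simp
    then show ?thesis using step[of "n + i"] unfolding D_def by simp
  qed
  have sums: "(\<lambda>i. \<tau> n / 4 * (1/2) ^ i) sums (\<tau> n / 4 * 2)"
    using sums_mult[OF geometric_sums[of "1/2::real"], of "\<tau> n / 4"] by simp
  then have summ: "summable (\<lambda>i. prob (D i))"
  proof (rule summable_comparison_test'[OF sums_summable])
    show "norm (prob (D i)) \<le> \<tau> n / 4 * (1/2) ^ i" if "i \<ge> 0" for i
      using bound[of i] by simp
  qed
  have "prob (sym_diff (A n) B) \<le> prob (\<Union>i. D i)"
    using cover D_sets by (intro finite_measure_mono) auto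
  also have "\<dots> \<le> (\<Sum>i. prob (D i))"
    using finite_measure_subadditive_countably[OF D_sets summ] .
  also have "\<dots> \<le> (\<Sum>i. \<tau> n / 4 * (1/2) ^ i)"
    by (rule suminf_le[OF bound summ sums_summable[OF sums]])
  also have "\<dots> = \<tau> n / 2" using sums_unique[OF sums] by simp
  finally show "prob (sym_diff (A n) B) < \<tau> n" using \<tau>(1)[of n] by simp
qed

text \<open>Baire's argument: the pairs of a nontrivial \<open>g\<close> and a natural number
  \<open>k\<close> are enumerated, and each step picks a smaller ball on which
  \<open>agree g\<close> has measure below \<open>1 / (k + 1)\<close>. The limit set lies in all
  these balls.\<close>

lemma exists_small_free_coding_set:
  assumes "p > 0"
  obtains A where "A \<in> sets M" "prob A < p" "\<And>g. g \<in> carrier G \<Longrightarrow> g \<noteq> \<one> \<Longrightarrow> prob (agree g A) = 0"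
proof -
  define T where "T = (carrier G - {\<one>}) \<times> (UNIV :: nat set)"
  define s where "s = from_nat_into T"
  have "carrier G \<noteq> {\<one>}" using infinite_carrier by auto
  then have "T \<noteq> {}" unfolding T_def by auto
  moreover have "countable T" unfolding T_def using countable_carrier by auto
  ultimately have s: "range s = T" unfolding s_def by (rule range_from_nat_into)
  \<comment> \<open>Starting from the ball of radius \<open>p\<close> around the empty set forces
    the limit to have measure less than \<open>p\<close>.\<close>
  define P where "P n = (\<lambda>(A, \<tau>). A \<in> sets M \<and> \<tau> > 0 \<and> (n = 0 \<longrightarrow> A = {} \<and> \<tau> = p))" for n :: nat
  define R where "R n = (\<lambda>(A, \<tau>) (A', \<tau>'). prob (sym_diff A A') < \<tau> / 4 \<and> \<tau>' \<le> \<tau> / 2 \<and>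
    (\<forall>B\<in>sets M. prob (sym_diff A' B) < \<tau>' \<longrightarrow> prob (agree (fst (s n)) B) < 1 / real (Suc (snd (s n)))))" for n
  have "\<exists>f. \<forall>n. P n (f n) \<and> R n (f n) (f (Suc n))"
  proof (rule dependent_nat_choice)
    show "\<exists>x. P 0 x" unfolding P_def using assms by (intro exI[of _ "({}, p)"]) auto
    fix x n assume "P n x"
    moreover obtain A \<tau> where x: "x = (A, \<tau>)" by fastforce
    ultimately have A: "A \<in> sets M" "\<tau> > 0" unfolding P_def by auto
    have "s n \<in> T" using s by blast
    then have g: "fst (s n) \<in> carrier G" "fst (s n) \<noteq> \<one>" unfolding T_def by auto
    obtain A' \<tau>' where "A' \<in> sets M" "prob (sym_diff A A') < \<tau> / 4" "\<tau>' > 0" "\<tau>' \<le> \<tau> / 2"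
      "\<And>B. B \<in> sets M \<Longrightarrow> prob (sym_diff A' B) < \<tau>' \<Longrightarrow> prob (agree (fst (s n)) B) < 1 / real (Suc (snd (s n)))"
      using agree_open_dense[OF g A, of "1 / real (Suc (snd (s n)))"] by auto
    then show "\<exists>y. P (Suc n) y \<and> R n x y"
      unfolding P_def R_def x by (intro exI[of _ "(A', \<tau>')"]) auto
  qed
  then obtain f where f: "\<And>n. P n (f n)" "\<And>n. R n (f n) (f (Suc n))" by blast
  define A where "A n = fst (f n)" for n
  define \<tau> where "\<tau> n = snd (f n)" for n
  have PA: "A n \<in> sets M" "\<tau> n > 0" for n
    using f(1)[of n] unfolding P_def A_def \<tau>_def by (auto split: prod.splits)
  have init: "A 0 = {}" "\<tau> 0 = p"
    using f(1)[of 0] unfolding P_def A_def \<tau>_def by (auto split: prod.splits)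
  have RA: "prob (sym_diff (A n) (A (Suc n))) < \<tau> n / 4" "\<tau> (Suc n) \<le> \<tau> n / 2"
    "\<And>B. B \<in> sets M \<Longrightarrow> prob (sym_diff (A (Suc n)) B) < \<tau> (Suc n) \<Longrightarrow>
      prob (agree (fst (s n)) B) < 1 / real (Suc (snd (s n)))" for n
    using f(2)[of n] unfolding R_def A_def \<tau>_def case_prod_beta by blast+
  obtain B where B: "B \<in> sets M" "\<And>n. prob (sym_diff (A n) B) < \<tau> n"
    using limit_set[of A \<tau>] PA RA by blast
  show ?thesis
  proof (rule that[OF B(1)])
    show "prob B < p" using B(2)[of 0] init by simp
    fix g assume g: "g \<in> carrier G" "g \<noteq> \<one>"
    have "prob (agree g B) < 1 / real (Suc k)" for k
    proof -
      have "(g, k) \<in> T" unfolding T_def using g by auto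
      then obtain n where "s n = (g, k)" using s by (metis imageE)
      then show ?thesis using RA(3)[OF B(1) B(2), of n] by simp
    qed
    then have "prob (agree g B) \<le> 0"
      using nat_approx_posE[of "prob (agree g B)"] by (metis less_asym not_le)
    then show "prob (agree g B) = 0" by (simp add: measure_le_0_iff)
  qed
qed

end

section \<open>Standard Borel spaces\<close>

lemma standard_borel_cong:
  assumes "sets M = sets N"
  shows "standard_borel M \<longleftrightarrow> standard_borel N"
  unfolding standard_borel_def using assms sets_eq_imp_space_eq[OF assms] by simp

text \<open>Small balls around a countable dense set form a countable base, and the complement of a
  finite set is open.\<close>

lemma standard_borel_separating_sequence:
  assumes "standard_borel M"
  obtains U :: "nat \<Rightarrow> 'a set" where "\<And>j. U j \<in> sets M"
    "\<And>x K. x \<in> space M \<Longrightarrow> finite K \<Longrightarrow> x \<notin> K \<Longrightarrow> \<exists>j. x \<in> U j \<and> U j \<inter> K = {}"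
proof -
  obtain T where T: "completely_metrizable_space T" "separable_space T" "topspace T = space M"
    "sets M = sigma_sets (topspace T) {U. openin T U}"
    using assms unfolding standard_borel_def by blast
  obtain S d where "Metric_space S d" and Teq: "T = Metric_space.mtopology S d"
    using T(1) unfolding completely_metrizable_space_def by blast
  interpret Metric_space S d by fact
  have S: "S = space M" using T(3) Teq by simp
  obtain C where C: "countable C" "C \<subseteq> S" "mtopology closure_of C = S"
    using T(2) unfolding separable_space_def Teq by auto
  \<comment> \<open>The empty set is inserted so that the family can be enumerated even when the
    space is empty.\<close>
  define \<U> where "\<U> = insert {} ((\<lambda>(c, n). mball c (1 / real (Suc n))) ` (C \<times> UNIV))"
  have \<U>: "countable \<U>" "\<U> \<noteq> {}" unfolding \<U>_def using C(1) by auto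
  show ?thesis
  proof (rule that[of "from_nat_into \<U>"])
    fix j
    have "from_nat_into \<U> j \<in> \<U>" using from_nat_into[OF \<U>(2)] .
    then have "openin T (from_nat_into \<U> j)" unfolding \<U>_def Teq by auto
    then show "from_nat_into \<U> j \<in> sets M" unfolding T(4) by auto
  next
    fix x K assume x: "x \<in> space M" and K: "finite K" "x \<notin> K"
    have "closedin mtopology (S \<inter> K)"
      using Hausdorff_imp_t1_space[OF Hausdorff_space_mtopology] K(1)
      unfolding t1_space_closedin_finite by simp
    then have "openin mtopology (S - K)"
      unfolding closedin_def by (simp add: Diff_Int)
    then obtain r where r: "r > 0" "mball x r \<subseteq> S - K"
      using x K(2) S unfolding openin_mtopology by blast
    \<comment> \<open>A centre within \<open>1 / (n + 1)\<close> of \<open>x\<close> and a ball of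
      the same radius around it together stay within distance \<open>r\<close> of
      \<open>x\<close>.\<close>
    obtain n where n: "1 / real (Suc n) < r / 2" using nat_approx_posE[of "r / 2"] r(1) by auto
    have "x \<in> mtopology closure_of C" using C(3) x S by simp
    then have "\<forall>r>0. \<exists>y\<in>C. y \<in> mball x r" unfolding metric_closure_of by blast
    moreover have "1 / real (Suc n) > 0" by simp
    ultimately obtain c where c: "c \<in> C" "c \<in> mball x (1 / real (Suc n))" by blast
    have "mball c (1 / real (Suc n)) \<subseteq> mball x r"
    proof
      fix y assume y: "y \<in> mball c (1 / real (Suc n))"
      then have "d x y \<le> d x c + d c y" using c by (intro triangle) auto
      then show "y \<in> mball x r" using y c n by auto
    qed
    then have "mball c (1 / real (Suc n)) \<inter> K = {}" using r(2) by blast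
    moreover have "x \<in> mball c (1 / real (Suc n))" using c by (auto simp: commute)
    moreover have "mball c (1 / real (Suc n)) \<in> range (from_nat_into \<U>)"
      unfolding range_from_nat_into[OF \<U>(2,1)] using c(1) by (auto simp: \<U>_def)
    ultimately show "\<exists>j. x \<in> from_nat_into \<U> j \<and> from_nat_into \<U> j \<inter> K = {}" by blast
  qed
qed

text \<open>The bijection is a homeomorphism from the pulled-back topology, and pulling back
  commutes with generating a sigma-algebra. This transports the shift space to a set of
  reals.\<close>

lemma standard_borel_vimage_algebra:
  assumes N: "standard_borel N" and f: "bij_betw f S (space N)"
  shows "standard_borel (vimage_algebra S f N)"
proof -
  obtain T where T: "completely_metrizable_space T" "separable_space T" "topspace T = space N"
    "sets N = sigma_sets (topspace T) {U. openin T U}"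
    using N unfolding standard_borel_def by blast
  have fS: "f ` S = space N" "inj_on f S" "f \<in> S \<rightarrow> space N"
    using f by (auto simp: bij_betw_def)
  let ?T = "pullback_topology S f T"
  have top: "topspace ?T = S"
    unfolding topspace_pullback_topology T(3) using fS by auto
  have inj: "U = V" if "U \<subseteq> space N" "V \<subseteq> space N" "f -` U \<inter> S = f -` V \<inter> S" for U V
  proof -
    have "f ` (f -` W \<inter> S) = W \<inter> f ` S" for W by auto
    then have "f ` (f -` W \<inter> S) = W" if "W \<subseteq> space N" for W using that fS(1) by auto
    then show ?thesis using that by metis
  qed
  have "homeomorphic_map ?T T f"
    unfolding homeomorphic_map_def quotient_map_def top T(3)
  proof (intro conjI allI impI)
    fix U assume U: "U \<subseteq> space N"
    have eq: "{x \<in> S. f x \<in> U} = f -` U \<inter> S" by auto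
    show "openin ?T {x \<in> S. f x \<in> U} = openin T U"
      unfolding eq openin_pullback_topology using inj[OF U] openin_subset[of T] T(3) by metis
  qed (use fS in auto)
  then have hom: "?T homeomorphic_space T" by (rule homeomorphic_map_imp_homeomorphic_space)
  have "sets (vimage_algebra S f N) = {f -` A \<inter> S |A. A \<in> sigma_sets (space N) {U. openin T U}}"
    using sets_vimage_algebra2[OF fS(3)] T(3,4) by simp
  also have "\<dots> = sigma_sets S {f -` A \<inter> S |A. A \<in> {U. openin T U}}"
    by (rule sigma_sets_vimage_commute[OF fS(3)])
  also have "{f -` A \<inter> S |A. A \<in> {U. openin T U}} = {U. openin ?T U}"
    unfolding openin_pullback_topology by auto
  finally show ?thesis
    unfolding standard_borel_def
    using top T(1,2) homeomorphic_completely_metrizable_space[OF hom] homeomorphic_separable_space[OF hom]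
    by (intro exI[of _ ?T]) simp
qed

section \<open>The binary product space\<close>

text \<open>The product of countably many discrete two-point spaces is Polish. Its countable base of
  cylinders makes the Borel sets of the topology coincide with the product sigma-algebra.\<close>

lemma standard_borel_PiM_bool:
  assumes I: "countable I"
  shows "standard_borel (PiM I (\<lambda>_. count_space (UNIV :: bool set)))"
proof -
  let ?N = "PiM I (\<lambda>_. count_space (UNIV :: bool set))"
  define T where "T = product_topology (\<lambda>_. discrete_topology (UNIV :: bool set)) I"
  have top: "topspace T = (\<Pi>\<^sub>E i\<in>I. UNIV)" unfolding T_def by simp
  have space: "space ?N = (\<Pi>\<^sub>E i\<in>I. UNIV)" by (simp add: space_PiM)
  define cyl where "cyl K z = {w \<in> (\<Pi>\<^sub>E i\<in>I. UNIV :: bool set). \<forall>i\<in>K. w i = z i}" for K z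
  have cyl_open: "openin T (cyl K z)" if "finite K" "K \<subseteq> I" for K z
    unfolding T_def openin_product_topology_alt
  proof
    fix x assume x: "x \<in> cyl K z"
    let ?U = "\<lambda>i. if i \<in> K then {z i} else UNIV"
    show "\<exists>U. finite {i \<in> I. U i \<noteq> topspace (discrete_topology UNIV)} \<and>
        (\<forall>i\<in>I. openin (discrete_topology UNIV) (U i)) \<and> x \<in> Pi\<^sub>E I U \<and> Pi\<^sub>E I U \<subseteq> cyl K z"
    proof (intro exI[of _ ?U] conjI)
      show "finite {i \<in> I. ?U i \<noteq> topspace (discrete_topology UNIV)}"
        by (rule finite_subset[OF _ that(1)]) auto
      show "x \<in> Pi\<^sub>E I ?U" using x by (auto simp: cyl_def PiE_iff)
      show "Pi\<^sub>E I ?U \<subseteq> cyl K z"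
      proof
        fix w assume w: "w \<in> Pi\<^sub>E I ?U"
        have "w i = z i" if i: "i \<in> K" for i
          using PiE_mem[OF w subsetD[OF \<open>K \<subseteq> I\<close> i]] i by simp
        then show "w \<in> cyl K z" using w by (auto simp: cyl_def PiE_iff)
      qed
    qed auto
  qed
  have open_cyl: "\<exists>K. finite K \<and> K \<subseteq> I \<and> cyl K z \<subseteq> V" if V: "openin T V" "z \<in> V" for V z
  proof -
    obtain U where U: "finite {i \<in> I. U i \<noteq> UNIV}" "z \<in> Pi\<^sub>E I U" "Pi\<^sub>E I U \<subseteq> V"
      using V unfolding T_def openin_product_topology_alt by auto
    have "cyl {i \<in> I. U i \<noteq> UNIV} z \<subseteq> Pi\<^sub>E I U"
    proof
      fix w assume w: "w \<in> cyl {i \<in> I. U i \<noteq> UNIV} z"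
      have "w i \<in> U i" if "i \<in> I" for i
        using w that PiE_mem[OF U(2) that] by (cases "U i = UNIV") (auto simp: cyl_def)
      then show "w \<in> Pi\<^sub>E I U" using w by (auto simp: cyl_def PiE_iff)
    qed
    then show ?thesis using U by (intro exI[of _ "{i \<in> I. U i \<noteq> UNIV}"]) auto
  qed
  \<comment> \<open>A cylinder over a finite \<open>K\<close> is already centred at the indicator of
    a finite set. So these indicators are dense, and there are only countably many such
    cylinders.\<close>
  define ind where "ind L = (\<lambda>i\<in>I. i \<in> L)" for L
  define \<F> where "\<F> = {K. K \<subseteq> I \<and> finite K}"
  have \<F>: "countable \<F>"
    unfolding \<F>_def using countable_Collect_finite_subset[OF I] by (simp add: conj_commute)
  have approx: "\<exists>L\<in>\<F>. L \<subseteq> K \<and> cyl K z = cyl K (ind L)" if "K \<in> \<F>" for K z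
  proof (intro bexI[of _ "{i \<in> K. z i}"] conjI)
    show "cyl K z = cyl K (ind {i \<in> K. z i})"
      using that by (auto simp: cyl_def ind_def \<F>_def)
    show "{i \<in> K. z i} \<in> \<F>" using that by (auto simp: \<F>_def)
  qed auto
  have ind_space: "ind L \<in> (\<Pi>\<^sub>E i\<in>I. UNIV)" for L unfolding ind_def by auto
  have "completely_metrizable_space T"
    unfolding T_def completely_metrizable_space_product_topology
    using I countable_subset[of _ I] completely_metrizable_space_discrete_topology by auto
  moreover have "separable_space T"
    unfolding separable_space_def
  proof (intro exI[of _ "ind ` \<F>"] conjI)
    show "ind ` \<F> \<subseteq> topspace T" unfolding top using ind_space by blast
    show "T closure_of ind ` \<F> = topspace T"
    proof (intro equalityI closure_of_subset_topspace subsetI)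
      fix z assume z: "z \<in> topspace T"
      show "z \<in> T closure_of ind ` \<F>"
        unfolding in_closure_of
      proof (intro conjI z allI impI)
        fix V assume "z \<in> V \<and> openin T V"
        then obtain K where K: "K \<in> \<F>" "cyl K z \<subseteq> V" using open_cyl unfolding \<F>_def by blast
        then obtain L where "L \<in> \<F>" "cyl K z = cyl K (ind L)" using approx by blast
        then have "ind L \<in> cyl K z" using ind_space unfolding cyl_def by auto
        then show "\<exists>y. y \<in> ind ` \<F> \<and> y \<in> V" using K \<open>L \<in> \<F>\<close> by blast
      qed
    qed
  qed (use \<F> in auto)
  moreover have "sets ?N = sigma_sets (topspace T) {U. openin T U}"
  proof
    show "sets ?N \<subseteq> sigma_sets (topspace T) {U. openin T U}"
      unfolding sets_PiM_single top
    proof (simp only: space_count_space, rule sigma_sets_mono, rule subsetI)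
      fix A assume "A \<in> {{f \<in> \<Pi>\<^sub>E i\<in>I. UNIV. f i \<in> A} |i A. i \<in> I \<and> A \<in> sets (count_space (UNIV :: bool set))}"
      then obtain i B where A: "A = {f \<in> \<Pi>\<^sub>E i\<in>I. UNIV. f i \<in> B}" and i: "i \<in> I" by blast
      have "A = (\<Union>b\<in>B. cyl {i} (\<lambda>_. b))" unfolding A cyl_def by auto
      moreover have "openin T (\<Union>b\<in>B. cyl {i} (\<lambda>_. b))"
        by (rule openin_Union) (use i cyl_open in auto)
      ultimately show "A \<in> sigma_sets (\<Pi>\<^sub>E i\<in>I. UNIV) {U. openin T U}" by auto
    qed
    have cyl_sets: "cyl K z \<in> sets ?N" if "K \<in> \<F>" for K z
    proof -
      have "{w \<in> space ?N. \<forall>i\<in>K. w i = z i} \<in> sets ?N"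
      proof (rule sets.sets_Collect_countable_All')
        show "countable K" using that unfolding \<F>_def by (auto intro: countable_finite)
        fix i assume "i \<in> K"
        then have [measurable]: "i \<in> I" using that unfolding \<F>_def by auto
        show "{w \<in> space ?N. w i = z i} \<in> sets ?N" by measurable
      qed
      then show ?thesis unfolding cyl_def space .
    qed
    have "{U. openin T U} \<subseteq> sets ?N"
    proof
      fix V assume "V \<in> {U. openin T U}"
      then have V: "openin T V" by simp
      \<comment> \<open>Indexing by pairs of finite sets writes an open set as a countable union of
        measurable cylinders.\<close>
      define \<C> where "\<C> = {(K, L) \<in> \<F> \<times> \<F>. cyl K (ind L) \<subseteq> V}"
      have "V = (\<Union>p\<in>\<C>. cyl (fst p) (ind (snd p)))"
      proof
        show "V \<subseteq> (\<Union>p\<in>\<C>. cyl (fst p) (ind (snd p)))"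
        proof
          fix z assume z: "z \<in> V"
          then obtain K where K: "K \<in> \<F>" "cyl K z \<subseteq> V" using open_cyl V unfolding \<F>_def by blast
          then obtain L where "L \<in> \<F>" "cyl K z = cyl K (ind L)" using approx by blast
          moreover have "z \<in> cyl K z" using openin_subset[OF V] z top unfolding cyl_def by auto
          ultimately show "z \<in> (\<Union>p\<in>\<C>. cyl (fst p) (ind (snd p)))"
            using K unfolding \<C>_def by force
        qed
      qed (auto simp: \<C>_def)
      moreover have "countable \<C>"
        by (rule countable_subset[of _ "\<F> \<times> \<F>"]) (use \<F> in \<open>auto simp: \<C>_def\<close>)
      then have "(\<Union>p\<in>\<C>. cyl (fst p) (ind (snd p))) \<in> sets ?N"
        using cyl_sets by (intro sets.countable_UN') (auto simp: \<C>_def)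
      ultimately show "V \<in> sets ?N" by simp
    qed
    then have "sigma_sets (space ?N) {U. openin T U} \<subseteq> sets ?N"
      by (rule sets.sigma_sets_subset)
    then show "sigma_sets (topspace T) {U. openin T U} \<subseteq> sets ?N"
      by (simp only: top space)
  qed
  ultimately show ?thesis
    unfolding standard_borel_def using top space by (intro exI[of _ T]) simp
qed

section \<open>Entropy of a two-piece partition\<close>

lemma binary_entropy_small:
  assumes "\<epsilon> > 0"
  obtains p\<^sub>0 :: real where "p\<^sub>0 > 0"
    "\<And>p. 0 \<le> p \<Longrightarrow> p < p\<^sub>0 \<Longrightarrow> - (p * ln p) - (1 - p) * ln (1 - p) < \<epsilon>"
proof -
  have "((\<lambda>p::real. - (p * ln p) - (1 - p) * ln (1 - p)) \<longlongrightarrow> 0) (at_right 0)" by real_asymp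
  then have "eventually (\<lambda>p. - (p * ln p) - (1 - p) * ln (1 - p) < \<epsilon>) (at_right 0)"
    using assms by (rule order_tendstoD(2))
  then obtain b where b: "b > 0" "\<And>p. p > 0 \<Longrightarrow> p < b \<Longrightarrow> - (p * ln p) - (1 - p) * ln (1 - p) < \<epsilon>"
    unfolding eventually_at_right_field by auto
  show ?thesis
  proof (rule that[OF b(1)])
    \<comment> \<open>The limit is one-sided and says nothing at \<open>0\<close>; there the
      expression is \<open>0\<close>.\<close>
    fix p :: real assume "0 \<le> p" "p < b"
    then show "- (p * ln p) - (1 - p) * ln (1 - p) < \<epsilon>"
      using b(2) assms by (cases "p = 0") auto
  qed
qed

section \<open>The shift, carried by a set of real numbers\<close>

text \<open>The factor is to live on type \<open>real\<close>, so configurations are named by reals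
  through an injection. No measurability of \<open>enc\<close> is asked for: the sigma-algebra of
  \<open>R\<close> is transported through the decoding map.\<close>

locale real_shift = group G for G (structure) +
  fixes enc :: "('a \<Rightarrow> bool) \<Rightarrow> real"
  assumes countable_group: "countable (carrier G)"
    and inj_enc: "inj_on enc (carrier G \<rightarrow>\<^sub>E UNIV)"
begin

abbreviation N :: "('a \<Rightarrow> bool) measure" where
  "N \<equiv> PiM (carrier G) (\<lambda>_. count_space UNIV)"

definition S :: "real set" where "S = enc ` (carrier G \<rightarrow>\<^sub>E UNIV)"

definition dec :: "real \<Rightarrow> 'a \<Rightarrow> bool" where "dec = inv_into (carrier G \<rightarrow>\<^sub>E UNIV) enc"

definition R :: "real measure" where "R = vimage_algebra S dec N"

text \<open>Right translation of the argument makes this a left action and matches codes of the form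
  \<open>h x \<in> A\<close>: the code of \<open>g x\<close> at \<open>h\<close> is that of
  \<open>x\<close> at \<open>h \<otimes> g\<close>. Restriction to \<open>S\<close> gives the
  extensional functions that \<open>BijGroup\<close> requires.\<close>

definition shift :: "'a \<Rightarrow> real \<Rightarrow> real" where
  "shift g = (\<lambda>y\<in>S. enc (\<lambda>h\<in>carrier G. dec y (h \<otimes> g)))"

definition C :: "bool \<Rightarrow> real set" where "C b = {y \<in> S. dec y \<one> = b}"

lemma space_N: "space N = carrier G \<rightarrow>\<^sub>E UNIV"
  by (simp add: space_PiM)

lemma space_R: "space R = S"
  unfolding R_def by simp

lemma enc_in: "z \<in> carrier G \<rightarrow>\<^sub>E UNIV \<Longrightarrow> enc z \<in> S"
  unfolding S_def by blast

lemma dec_enc: "z \<in> carrier G \<rightarrow>\<^sub>E UNIV \<Longrightarrow> dec (enc z) = z"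
  unfolding dec_def using inj_enc by (rule inv_into_f_f)

lemma dec_in: "y \<in> S \<Longrightarrow> dec y \<in> carrier G \<rightarrow>\<^sub>E UNIV"
  unfolding dec_def S_def by (rule inv_into_into)

lemma enc_dec: "y \<in> S \<Longrightarrow> enc (dec y) = y"
  unfolding dec_def S_def by (rule f_inv_into_f[of y enc])

lemma S_eqI:
  assumes "y \<in> S" "y' \<in> S" "\<And>h. h \<in> carrier G \<Longrightarrow> dec y h = dec y' h"
  shows "y = y'"
proof -
  have "dec y = dec y'" using dec_in[OF assms(1)] dec_in[OF assms(2)] assms(3) by (rule PiE_ext)
  then show ?thesis using enc_dec assms(1,2) by metis
qed

lemma shift_in: "y \<in> S \<Longrightarrow> shift g y \<in> S"
  unfolding shift_def by (auto intro: enc_in)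

lemma dec_shift: "y \<in> S \<Longrightarrow> h \<in> carrier G \<Longrightarrow> dec (shift g y) h = dec y (h \<otimes> g)"
  unfolding shift_def by (simp add: dec_enc)

lemma shift_mult:
  assumes "y \<in> S" "g \<in> carrier G" "h \<in> carrier G"
  shows "shift (g \<otimes> h) y = shift g (shift h y)"
  by (rule S_eqI) (use assms in \<open>simp_all add: shift_in dec_shift m_assoc\<close>)

lemma shift_one: "y \<in> S \<Longrightarrow> shift \<one> y = y"
  by (rule S_eqI) (simp_all add: shift_in dec_shift)

lemma shift_inv:
  assumes "y \<in> S" "g \<in> carrier G"
  shows "shift (inv g) (shift g y) = y" "shift g (shift (inv g) y) = y"
  using assms by (simp_all add: shift_mult[symmetric] shift_one)

lemma group_action_shift: "group_action G S shift"
proof (intro group_action.intro group_hom.intro group_hom_axioms.intro homI)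
  show "group G" by (rule is_group)
  show "group (BijGroup S)" by (rule group_BijGroup)
  have Bij: "shift g \<in> Bij S" if g: "g \<in> carrier G" for g
  proof -
    have "bij_betw (shift g) S S"
      by (rule bij_betwI[where g = "shift (inv g)"]) (use g shift_in shift_inv in auto)
    then show ?thesis unfolding Bij_def shift_def by auto
  qed
  show "shift g \<in> carrier (BijGroup S)" if "g \<in> carrier G" for g
    using Bij[OF that] by (simp add: BijGroup_def)
  show "shift (g \<otimes> h) = shift g \<otimes>\<^bsub>BijGroup S\<^esub> shift h" if gh: "g \<in> carrier G" "h \<in> carrier G" for g h
  proof -
    have "shift (g \<otimes> h) = compose S (shift g) (shift h)"
    proof (rule extensionalityI)
      show "shift (g \<otimes> h) \<in> extensional S" unfolding shift_def by simp
      show "compose S (shift g) (shift h) \<in> extensional S" by simp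
      show "shift (g \<otimes> h) y = compose S (shift g) (shift h) y" if "y \<in> S" for y
        using shift_mult[OF that gh] that by (simp add: compose_eq)
    qed
    then show ?thesis using Bij gh by (simp add: BijGroup_def)
  qed
qed

section \<open>Measurability of the shift\<close>

lemma measurable_dec: "dec \<in> R \<rightarrow>\<^sub>M N"
  unfolding R_def by (rule measurable_vimage_algebra1) (auto simp: space_N dec_in)

text \<open>The sigma-algebra of \<open>R\<close> is generated by the coordinates of
  \<open>dec\<close>, so coordinates suffice.\<close>

lemma measurable_into_R:
  assumes "f \<in> space M \<rightarrow> S" "\<And>h. h \<in> carrier G \<Longrightarrow> (\<lambda>x. dec (f x) h) \<in> M \<rightarrow>\<^sub>M count_space UNIV"
  shows "f \<in> M \<rightarrow>\<^sub>M R"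
  unfolding R_def
proof (rule measurable_vimage_algebra2[OF assms(1)])
  show "(\<lambda>x. dec (f x)) \<in> M \<rightarrow>\<^sub>M N"
  proof (rule measurable_PiM_single')
    show "(\<lambda>x. dec (f x)) \<in> space M \<rightarrow> (\<Pi>\<^sub>E i\<in>carrier G. space (count_space UNIV))"
      using assms(1) dec_in by auto
  qed (use assms(2) in auto)
qed

lemma measurable_dec_component:
  assumes "h \<in> carrier G"
  shows "(\<lambda>y. dec y h) \<in> R \<rightarrow>\<^sub>M count_space UNIV"
  using measurable_compose[OF measurable_dec measurable_component_singleton[OF assms]] by simp

lemma measurable_shift:
  assumes g: "g \<in> carrier G"
  shows "shift g \<in> R \<rightarrow>\<^sub>M R"
proof (rule measurable_into_R)
  show "shift g \<in> space R \<rightarrow> S" using shift_in space_R by auto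
  fix h assume h: "h \<in> carrier G"
  have "(\<lambda>y. dec y (h \<otimes> g)) \<in> R \<rightarrow>\<^sub>M count_space UNIV"
    by (rule measurable_dec_component) (use g h in auto)
  then show "(\<lambda>y. dec (shift g y) h) \<in> R \<rightarrow>\<^sub>M count_space UNIV"
    by (rule measurable_cong[THEN iffD1, rotated]) (simp add: space_R dec_shift h)
qed

lemma sets_dec_component:
  assumes "h \<in> carrier G"
  shows "{y \<in> S. dec y h = b} \<in> sets R"
  using measurable_sets[OF measurable_dec_component[OF assms], of "{b}"]
  by (simp add: space_R vimage_def Int_def conj_commute)

lemma standard_borel_R: "standard_borel R"
  unfolding R_def
proof (rule standard_borel_vimage_algebra[OF standard_borel_PiM_bool[OF countable_group]])
  show "bij_betw dec S (space N)"
    unfolding space_N by (rule bij_betwI[where g = enc]) (auto simp: dec_in enc_in dec_enc enc_dec)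
qed

section \<open>The generating partition\<close>

lemma C_eq_False: "C False = S - C True"
  unfolding C_def by auto

lemma C_sets: "C b \<in> sets R"
  unfolding C_def by (rule sets_dec_component) simp

text \<open>Constant configurations witness this, whatever measure is put on \<open>R\<close>;
  \<open>partition_on\<close> demands nonempty pieces.\<close>

lemma C_nonempty: "C b \<noteq> {}"
proof -
  have "enc (\<lambda>h\<in>carrier G. b) \<in> C b"
    unfolding C_def by (auto simp: dec_enc enc_in)
  then show ?thesis by blast
qed

lemma borel_partition_C:
  assumes "sets M = sets R"
  shows "borel_partition M {C False, C True}"
proof -
  have "space M = S" using sets_eq_imp_space_eq[OF assms] space_R by simp
  moreover have "C False \<union> C True = S" "C False \<inter> C True = {}" unfolding C_def by auto
  ultimately show ?thesis
    unfolding borel_partition_def partition_on_def disjoint_def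
    using assms C_sets C_nonempty[of True] C_nonempty[of False] by auto
qed

text \<open>Translates of the cylinder at \<open>\<one>\<close> are the cylinders at all other
  coordinates, and these generate the product sigma-algebra.\<close>

lemma generating_C:
  assumes "sets M = sets R"
  shows "generating_partition G M shift {C False, C True}"
  unfolding generating_partition_def
proof (intro conjI borel_partition_C[OF assms] equalityI)
  have space: "space M = S" using sets_eq_imp_space_eq[OF assms] space_R by simp
  \<comment> \<open>Invariance is phrased with images, measurability with preimages; the inverse
    element converts one into the other.\<close>
  have image: "shift g ` A = shift (inv g) -` A \<inter> S" if g: "g \<in> carrier G" and A: "A \<subseteq> S" for g A
  proof
    show "shift g ` A \<subseteq> shift (inv g) -` A \<inter> S" using g A shift_in shift_inv by auto
    show "shift (inv g) -` A \<inter> S \<subseteq> shift g ` A"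
    proof
      fix y assume "y \<in> shift (inv g) -` A \<inter> S"
      then show "y \<in> shift g ` A" using shift_inv(2)[OF _ g, of y] by (intro image_eqI) auto
    qed
  qed
  have "shift g ` A \<in> sets R" if g: "g \<in> carrier G" and A: "A \<in> sets R" for g A
    using measurable_sets[OF measurable_shift[OF inv_closed[OF g]] A] image[OF g]
      sets.sets_into_space[OF A] space_R by simp
  then have "invariant_sigma_algebra G shift (space M) (sets M)"
    using sets.sigma_algebra_axioms[of M]
    unfolding invariant_sigma_algebra_def assms by blast
  then show "\<Inter> {\<S>. invariant_sigma_algebra G shift (space M) \<S> \<and> {C False, C True} \<subseteq> \<S>} \<subseteq> sets M"
    using C_sets assms by auto
  show "sets M \<subseteq> \<Inter> {\<S>. invariant_sigma_algebra G shift (space M) \<S> \<and> {C False, C True} \<subseteq> \<S>}"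
  proof safe
    fix A \<S> assume A: "A \<in> sets M" and "invariant_sigma_algebra G shift (space M) \<S>"
      and CS: "{C False, C True} \<subseteq> \<S>"
    then have sigma: "sigma_algebra S \<S>"
      and inv: "\<And>g B. g \<in> carrier G \<Longrightarrow> B \<in> \<S> \<Longrightarrow> shift g ` B \<in> \<S>"
      unfolding invariant_sigma_algebra_def space by auto
    interpret sigma_algebra S \<S> by (rule sigma)
    have coord: "{y \<in> S. dec y h \<in> B} \<in> \<S>" if h: "h \<in> carrier G" for h B
    proof -
      have True_in: "{y \<in> S. dec y h} \<in> \<S>"
      proof -
        \<comment> \<open>The image is the preimage of \<open>C True\<close> under
          \<open>shift h\<close>, and \<open>shift h y\<close> at \<open>\<one>\<close> is
          \<open>y\<close> at \<open>h\<close>.\<close>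
        have "shift (inv h) ` C True = {y \<in> S. dec y h}"
          using image[of "inv h" "C True"] h by (auto simp: C_def shift_in dec_shift)
        then show ?thesis using inv[of "inv h" "C True"] CS h by auto
      qed
      have "{y \<in> S. dec y h \<in> B} =
          (if True \<in> B then {y \<in> S. dec y h} else {}) \<union> (if False \<in> B then S - {y \<in> S. dec y h} else {})"
      proof (rule Set.set_eqI)
        fix y
        show "y \<in> {y \<in> S. dec y h \<in> B} \<longleftrightarrow> y \<in> (if True \<in> B then {y \<in> S. dec y h} else {}) \<union>
            (if False \<in> B then S - {y \<in> S. dec y h} else {})"
          by (cases "dec y h") auto
      qed
      then show ?thesis using True_in by auto
    qed
    define \<D> where "\<D> = {dec -` B \<inter> S | B. B \<in> {{f \<in> carrier G \<rightarrow>\<^sub>E UNIV. f i \<in> B} | i B.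
        i \<in> carrier G \<and> B \<in> sets (count_space (UNIV :: bool set))}}"
    have "sets R = {dec -` B \<inter> S | B. B \<in> sets N}"
      unfolding R_def by (rule sets_vimage_algebra2) (auto simp: space_N dec_in)
    also have "\<dots> = sigma_sets S \<D>"
      unfolding sets_PiM_single \<D>_def
      by (subst sigma_sets_vimage_commute) (auto simp: dec_in)
    finally have "A \<in> sigma_sets S \<D>" using A assms by simp
    moreover have "\<D> \<subseteq> \<S>"
    proof
      fix D assume "D \<in> \<D>"
      then obtain i B where i: "i \<in> carrier G" and D: "D = dec -` {f \<in> carrier G \<rightarrow>\<^sub>E UNIV. f i \<in> B} \<inter> S"
        unfolding \<D>_def by blast
      have "D = {y \<in> S. dec y i \<in> B}" unfolding D using dec_in by auto
      then show "D \<in> \<S>" using coord[OF i] by simp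
    qed
    ultimately show "A \<in> \<S>" using sigma_sets_subset[of \<D>] by blast
  qed
qed

text \<open>Generation holds at every point, so the whole space serves as the conull set.\<close>

lemma ae_generating_C:
  assumes "sets M = sets R"
  shows "ae_generating_partition G M shift {C False, C True}"
proof -
  have space: "space M = S" using sets_eq_imp_space_eq[OF assms] space_R by simp
  have S_sets: "S \<in> sets M" using sets.top[of M] space by simp
  have "sets (restrict_space M S) = sets R"
    using assms S_sets sets.sets_into_space[of _ R] space_R
    by (auto simp: sets_restrict_space_iff)
  moreover have "(\<lambda>P. P \<inter> S) ` {C False, C True} - {{}} = {C False, C True}"
  proof -
    have "C b \<inter> S = C b" for b unfolding C_def by auto
    then show ?thesis using C_nonempty by auto
  qed
  moreover have "shift g ` S = S" if "g \<in> carrier G" for g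
    using group_action.surj_prop[OF group_action_shift that] .
  ultimately show ?thesis
    unfolding ae_generating_partition_def using borel_partition_C[OF assms] S_sets generating_C space
    by (intro conjI bexI[of _ S] ballI) (simp_all, metis AE_space)
qed

section \<open>Freeness of the shift in coordinates\<close>

lemma stabilizer_shift_trivial_iff:
  assumes "y \<in> S"
  shows "stabilizer G shift y = {\<one>} \<longleftrightarrow>
    (\<forall>g\<in>carrier G - {\<one>}. \<exists>h\<in>carrier G. dec y (h \<otimes> g) \<noteq> dec y h)"
proof -
  have fix_iff: "shift g y = y \<longleftrightarrow> (\<forall>h\<in>carrier G. dec y (h \<otimes> g) = dec y h)" for g
  proof
    assume "shift g y = y"
    then show "\<forall>h\<in>carrier G. dec y (h \<otimes> g) = dec y h"
      using dec_shift[OF assms, of _ g] by simp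
  next
    assume "\<forall>h\<in>carrier G. dec y (h \<otimes> g) = dec y h"
    then show "shift g y = y"
      by (intro S_eqI shift_in assms) (simp add: dec_shift assms)
  qed
  have "stabilizer G shift y = {\<one>} \<longleftrightarrow> (\<forall>g\<in>carrier G - {\<one>}. shift g y \<noteq> y)"
    unfolding stabilizer_def using shift_one[OF assms] by auto
  then show ?thesis unfolding fix_iff by blast
qed

text \<open>In coordinates the condition is a countable combination of measurable ones.
  Measurability is what allows freeness almost everywhere to be pulled back along the coding
  map.\<close>

lemma sets_trivial_stabilizer: "{y \<in> S. stabilizer G shift y = {\<one>}} \<in> sets R"
proof -
  have "{y \<in> space R. \<forall>g\<in>carrier G - {\<one>}. \<exists>h\<in>carrier G. dec y (h \<otimes> g) \<noteq> dec y h} \<in> sets R"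
  proof (intro sets.sets_Collect_countable_All' sets.sets_Collect_countable_Ex')
    fix g h assume gh: "g \<in> carrier G - {\<one>}" "h \<in> carrier G"
    have [measurable]: "(\<lambda>y. dec y (h \<otimes> g)) \<in> R \<rightarrow>\<^sub>M count_space UNIV"
      "(\<lambda>y. dec y h) \<in> R \<rightarrow>\<^sub>M count_space UNIV"
      using gh by (auto intro!: measurable_dec_component)
    show "{y \<in> space R. dec y (h \<otimes> g) \<noteq> dec y h} \<in> sets R" by measurable
  qed (use countable_group in auto)
  also have "{y \<in> space R. \<forall>g\<in>carrier G - {\<one>}. \<exists>h\<in>carrier G. dec y (h \<otimes> g) \<noteq> dec y h}
      = {y \<in> S. stabilizer G shift y = {\<one>}}"
    using stabilizer_shift_trivial_iff space_R by auto
  finally show ?thesis .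
qed

end

text \<open>Configurations correspond to subsets of a countable set, and sets of naturals are
  equinumerous with the reals.\<close>

lemma real_shift_exists:
  assumes "group G" "countable (carrier G)"
  obtains enc where "real_shift G enc"
proof -
  obtain b :: "nat set \<Rightarrow> real" where b: "inj b"
    using nat_sets_eqpoll_reals unfolding eqpoll_def bij_betw_def by blast
  define enc where "enc z = b (to_nat_on (carrier G) ` {h \<in> carrier G. z h})" for z
  have "inj_on enc (carrier G \<rightarrow>\<^sub>E UNIV)"
  proof (rule inj_onI)
    fix z w assume zw: "z \<in> carrier G \<rightarrow>\<^sub>E (UNIV :: bool set)" "w \<in> carrier G \<rightarrow>\<^sub>E UNIV" and "enc z = enc w"
    then have "to_nat_on (carrier G) ` {h \<in> carrier G. z h} = to_nat_on (carrier G) ` {h \<in> carrier G. w h}"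
      unfolding enc_def using injD[OF b] by blast
    then have "{h \<in> carrier G. z h} = {h \<in> carrier G. w h}"
      using inj_on_image_eq_iff[OF inj_on_to_nat_on[OF assms(2)], of "{h \<in> carrier G. z h}" "{h \<in> carrier G. w h}"]
      by auto
    then show "z = w" by (intro PiE_ext[OF zw]) blast
  qed
  then show ?thesis
    using that[of enc] assms by (simp add: real_shift_def real_shift_axioms_def)
qed

section \<open>The coding factor\<close>

theorem corollary2p6:
  fixes G :: "('g, 'b) monoid_scheme"
    and X :: "'a measure"
    and \<alpha> :: "'g \<Rightarrow> 'a \<Rightarrow> 'a"
    and \<epsilon> :: real
  assumes "group G" and "countable (carrier G)" and "infinite (carrier G)"
    and "free_pmp_action G X \<alpha>"
    and "\<epsilon> > 0"
  shows "\<exists>(Z :: real measure) \<beta> f C\<^sub>0 C\<^sub>1.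
           free_pmp_action G Z \<beta> \<and>
           factor_map G X \<alpha> Z \<beta> f \<and>
           C\<^sub>0 \<noteq> C\<^sub>1 \<and> ae_generating_partition G Z \<beta> {C\<^sub>0, C\<^sub>1} \<and>
           shannon_entropy Z {C\<^sub>0, C\<^sub>1} < ennreal \<epsilon>"
proof -
  have X: "standard_borel X" "prob_space X" "group_action G (space X) \<alpha>"
    "\<And>g. g \<in> carrier G \<Longrightarrow> \<alpha> g \<in> X \<rightarrow>\<^sub>M X" "\<And>g. g \<in> carrier G \<Longrightarrow> distr X X (\<alpha> g) = X"
    "AE x in X. stabilizer G \<alpha> x = {\<one>\<^bsub>G\<^esub>}"
    using assms(4) unfolding free_pmp_action_def pmp_action_def by auto
  obtain U :: "nat \<Rightarrow> 'a set" where U: "\<And>j. U j \<in> sets X"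
    "\<And>x K. x \<in> space X \<Longrightarrow> finite K \<Longrightarrow> x \<notin> K \<Longrightarrow> \<exists>j. x \<in> U j \<and> U j \<inter> K = {}"
    using standard_borel_separating_sequence[OF X(1)] by blast
  interpret act: separated_free_pmp_action G X \<alpha> U
    unfolding separated_free_pmp_action_def separated_free_pmp_action_axioms_def
    using assms(1-3) X U by blast
  obtain enc where "real_shift G enc" using real_shift_exists[OF assms(1,2)] by blast
  then interpret real_shift G enc .
  obtain p\<^sub>0 where p\<^sub>0: "p\<^sub>0 > 0"
    "\<And>p. 0 \<le> p \<Longrightarrow> p < p\<^sub>0 \<Longrightarrow> - (p * ln p) - (1 - p) * ln (1 - p) < \<epsilon>"
    using binary_entropy_small[OF assms(5)] by blast
  obtain A where A: "A \<in> sets X" "act.prob A < p\<^sub>0"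
    "\<And>g. g \<in> carrier G \<Longrightarrow> g \<noteq> \<one>\<^bsub>G\<^esub> \<Longrightarrow> act.prob (act.agree g A) = 0"
    using act.exists_small_free_coding_set[OF p\<^sub>0(1)] by blast
  define f where "f x = enc (\<lambda>h\<in>carrier G. \<alpha> h x \<in> A)" for x
  have f_in: "f x \<in> S" for x unfolding f_def by (intro enc_in) auto
  have dec_f: "dec (f x) h \<longleftrightarrow> \<alpha> h x \<in> A" if "h \<in> carrier G" for x h
    unfolding f_def using that by (simp add: dec_enc)
  have f_meas: "f \<in> X \<rightarrow>\<^sub>M R"
  proof (rule measurable_into_R)
    fix h assume h: "h \<in> carrier G"
    have [measurable]: "\<alpha> h \<in> X \<rightarrow>\<^sub>M X" "A \<in> sets X" using X(4)[OF h] A(1) by auto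
    have "(\<lambda>x. \<alpha> h x \<in> A) \<in> X \<rightarrow>\<^sub>M count_space UNIV" by measurable
    then show "(\<lambda>x. dec (f x) h) \<in> X \<rightarrow>\<^sub>M count_space UNIV" by (simp add: dec_f h)
  qed (use f_in in auto)
  have equiv: "f (\<alpha> g x) = shift g (f x)" if g: "g \<in> carrier G" and x: "x \<in> space X" for g x
  proof (rule S_eqI)
    fix h assume h: "h \<in> carrier G"
    show "dec (f (\<alpha> g x)) h = dec (shift g (f x)) h"
      using g h x by (simp add: dec_shift f_in dec_f act.act_mult)
  qed (simp_all add: f_in shift_in)
  \<comment> \<open>\<open>Z\<close> is \<open>R\<close> with the pushed-forward measure; its
    measurable sets are those of \<open>R\<close>.\<close>
  define Z where "Z = distr X R f"
  have sets_Z: "sets Z = sets R" and space_Z: "space Z = S"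
    unfolding Z_def using space_R by auto
  have f_meas_Z: "f \<in> X \<rightarrow>\<^sub>M Z" using f_meas measurable_cong_sets[OF refl sets_Z] by blast
  have distr_Z: "distr X Z f = Z"
    unfolding Z_def by (rule distr_cong) auto
  have shift_meas: "shift g \<in> Z \<rightarrow>\<^sub>M Z" if "g \<in> carrier G" for g
    using measurable_shift[OF that] measurable_cong_sets[OF sets_Z sets_Z] by blast
  have shift_pres: "distr Z Z (shift g) = Z" if g: "g \<in> carrier G" for g
  proof -
    \<comment> \<open>By equivariance, shifting after coding is coding after acting, and acting
      preserves the measure of \<open>X\<close>.\<close>
    have "distr Z Z (shift g) = distr (distr X Z f) Z (shift g)" by (simp only: distr_Z)
    also have "\<dots> = distr X Z (shift g \<circ> f)" by (rule distr_distr[OF shift_meas[OF g] f_meas_Z])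
    also have "\<dots> = distr X Z (f \<circ> \<alpha> g)" by (rule distr_cong) (simp_all add: equiv g)
    also have "\<dots> = distr (distr X X (\<alpha> g)) Z f" by (rule distr_distr[OF f_meas_Z X(4)[OF g], symmetric])
    also have "\<dots> = Z" using X(5)[OF g] distr_Z by simp
    finally show ?thesis .
  qed
  interpret Z: prob_space Z unfolding Z_def by (rule act.prob_space_distr[OF f_meas])
  have "pmp_action G Z shift"
    unfolding pmp_action_def space_Z
    using standard_borel_cong[OF sets_Z] standard_borel_R Z.prob_space_axioms group_action_shift
      shift_meas shift_pres by blast
  moreover have "AE y in Z. stabilizer G shift y = {\<one>\<^bsub>G\<^esub>}"
  proof -
    \<comment> \<open>Countably many null sets are discarded; any remaining point has a code moved
      by every nontrivial \<open>g\<close>.\<close>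
    have "AE x in X. \<forall>g\<in>carrier G - {\<one>\<^bsub>G\<^esub>}. x \<notin> act.agree g A"
    proof (subst AE_ball_countable)
      show "\<forall>g\<in>carrier G - {\<one>\<^bsub>G\<^esub>}. AE x in X. x \<notin> act.agree g A"
        using A(3) act.sets_agree[OF _ A(1)] by (auto simp: act.prob_eq_0)
    qed (use assms(2) in auto)
    then have "AE x in X. stabilizer G shift (f x) = {\<one>\<^bsub>G\<^esub>}"
      using AE_space
    proof eventually_elim
      case (elim x)
      show ?case
        unfolding stabilizer_shift_trivial_iff[OF f_in]
      proof
        fix g assume g: "g \<in> carrier G - {\<one>\<^bsub>G\<^esub>}"
        then have "x \<notin> act.agree g A" using elim(1) by blast
        then obtain h where "h \<in> carrier G" "(\<alpha> h (\<alpha> g x) \<in> A) \<noteq> (\<alpha> h x \<in> A)"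
          unfolding act.agree_def using elim(2) by blast
        then show "\<exists>h\<in>carrier G. dec (f x) (h \<otimes>\<^bsub>G\<^esub> g) \<noteq> dec (f x) h"
          using g elim(2) by (intro bexI[of _ h]) (simp_all add: dec_f act.act_mult)
      qed
    qed
    moreover have "{y \<in> space R. stabilizer G shift y = {\<one>\<^bsub>G\<^esub>}} \<in> sets R"
      using sets_trivial_stabilizer space_R by simp
    ultimately show ?thesis
      unfolding Z_def using AE_distr_iff[OF f_meas, where P = "\<lambda>y. stabilizer G shift y = {\<one>\<^bsub>G\<^esub>}"] by simp
  qed
  ultimately have free_Z: "free_pmp_action G Z shift" unfolding free_pmp_action_def by blast
  have factor: "factor_map G X \<alpha> Z shift f"
    unfolding factor_map_def using f_meas_Z distr_Z equiv by blast
  have C_neq: "C False \<noteq> C True" using C_nonempty[of True] unfolding C_def by auto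
  \<comment> \<open>The code at \<open>\<one>\<close> records whether the point itself lies in
    \<open>A\<close>.\<close>
  have "f -` C True \<inter> space X = A"
    using sets.sets_into_space[OF A(1)] act.act_one by (auto simp: C_def f_in dec_f)
  then have True_prob: "Z.prob (C True) = act.prob A"
    unfolding Z_def using measure_distr[OF f_meas C_sets] by simp
  \<comment> \<open>\<open>ennreal\<close> truncates negative reals to zero, so the two summands may
    be merged only once they are known to be nonnegative.\<close>
  have nonneg: "0 \<le> - (q * ln q)" if "0 \<le> q" "q \<le> 1" for q :: real
    using that by (cases "q = 0") (simp_all add: mult_nonneg_nonpos)
  have "Z.prob (C False) = 1 - act.prob A"
    using Z.prob_compl[of "C True"] C_sets sets_Z True_prob by (simp add: C_eq_False space_Z)
  then have "shannon_entropy Z {C False, C True} =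
      ennreal (- ((1 - act.prob A) * ln (1 - act.prob A))) + ennreal (- (act.prob A * ln (act.prob A)))"
    unfolding shannon_entropy_def using True_prob C_neq by simp
  also have "\<dots> = ennreal (- (act.prob A * ln (act.prob A)) - (1 - act.prob A) * ln (1 - act.prob A))"
    using nonneg[of "act.prob A"] nonneg[of "1 - act.prob A"] act.prob_le_1[of A]
    by (simp add: ennreal_plus[symmetric] del: ennreal_plus)
  also have "\<dots> < ennreal \<epsilon>"
    using p\<^sub>0(2)[OF measure_nonneg A(2)] assms(5) by (simp add: ennreal_less_iff ennreal_lessI)
  finally show ?thesis
    using free_Z factor C_neq ae_generating_C[OF sets_Z] by blast
qed

end
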